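(* Let $n\ge 2$ be an integer and let $D_n$ be the dihedral group of order $2n$. The co-maximal hypergraph $Co_{\mathcal{H}}(D_n)$ is planar if and only if $n=p^{\alpha}$, where $p$ is a prime and $\alpha$ is a positive integer.
   Context: For $n\ge 1$, $D_n=\langle a,b \mid a^n=e,\ b^2=e,\ bab^{-1}=a^{-1}\rangle$ is the dihedral group of order $2n$ (so $D_2$ is the Klein four-group). For a group $G$, let $S$ be the set of all non-trivial proper subgroups of $G$ (i.e. subgroups different from $\{e\}$ and $G$). For subgroups $H,K$, $HK=\{hk : h\in H, k\in K\}$. The co-maximal hypergraph $Co_{\mathcal{H}}(G)$ has vertex set $V=\{H\in S : HK=G \text{ for some } K\in S\}$, and a subset $E\subseteq V$ is a hyperedge if and only if (1) $HK=G$ for all distinct $H,K\in E$, and (2) no subset $E'\subseteq V$ properly containing $E$ satisfies (1). The incidence graph $\mathcal{I}(\mathcal{H})$ of a hypergraph $\mathcal{H}$ is the bipartite graph with vertex set $V(\mathcal{H})\cup E(\mathcal{H})$ (disjoint union) in which $v\in V(\mathcal{H})$ is adjacent to $e\in E(\mathcal{H})$ if and only if $v\in e$. A hypergraph is planar if and only if its incidence graph is a planar graph. *)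

theory Defs
  imports
    "HOL-Analysis.Path_Connected"
    "HOL-Algebra.Coset"
    "HOL-Algebra.Generated_Groups"
    "HOL-Computational_Algebra.Primes"
begin

section \<open>Dihedral groups\<close>

text \<open>
  A group generated by elements satisfying the dihedral relations is a quotient of the presented
  group \<open>\<langle>a, b | a\<^sup>n = e, b\<^sup>2 = e, b a b\<inverse> = a\<inverse>\<rangle>\<close>. That group has order \<open>2n\<close>, so for \<open>n \<ge> 1\<close>
  having order \<open>2n\<close> singles it out up to isomorphism. For \<open>n = 2\<close> it is the Klein four-group.
\<close>

definition dihedral_group :: "nat \<Rightarrow> ('a, 'b) monoid_scheme \<Rightarrow> bool" where
  "dihedral_group n G \<longleftrightarrow>
     group G \<and> Coset.order G = 2 * n \<and>
     (\<exists>a\<in>carrier G. \<exists>b\<in>carrier G.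
        generate G {a, b} = carrier G \<and>
        a [^]\<^bsub>G\<^esub> n = \<one>\<^bsub>G\<^esub> \<and>
        b [^]\<^bsub>G\<^esub> (2::nat) = \<one>\<^bsub>G\<^esub> \<and>
        b \<otimes>\<^bsub>G\<^esub> a \<otimes>\<^bsub>G\<^esub> inv\<^bsub>G\<^esub> b = inv\<^bsub>G\<^esub> a)"

text \<open>
  A model for every \<open>n \<ge> 1\<close>: the pair \<open>(i, s)\<close> stands for \<open>a\<^sup>i\<close> if \<open>s\<close> is false and for
  \<open>a\<^sup>i b\<close> if \<open>s\<close> is true.
\<close>

definition dihedral_model :: "nat \<Rightarrow> (int \<times> bool) monoid" where
  "dihedral_model n =
     \<lparr>carrier = {0..<int n} \<times> UNIV,
      monoid.mult = (\<lambda>(i, s) (j, t). ((if s then i - j else i + j) mod int n, s \<noteq> t)),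
      one = (0, False)\<rparr>"

lemma dihedral_model_group:
  assumes "n \<ge> 1"
  shows "group (dihedral_model n)"
proof (rule groupI)
  fix x y z
  assume "x \<in> carrier (dihedral_model n)" "y \<in> carrier (dihedral_model n)"
    "z \<in> carrier (dihedral_model n)"
  then show "x \<otimes>\<^bsub>dihedral_model n\<^esub> y \<otimes>\<^bsub>dihedral_model n\<^esub> z =
      x \<otimes>\<^bsub>dihedral_model n\<^esub> (y \<otimes>\<^bsub>dihedral_model n\<^esub> z)"
    by (cases x; cases y; cases z)
       (auto simp: dihedral_model_def mod_simps algebra_simps)
next
  fix x
  assume x: "x \<in> carrier (dihedral_model n)"
  obtain i s where xi: "x = (i, s)"
    by (cases x)
  have "(if s then i else (- i) mod int n, s) \<in> carrier (dihedral_model n)"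
    using x xi assms by (auto simp: dihedral_model_def)
  moreover have "(if s then i else (- i) mod int n, s) \<otimes>\<^bsub>dihedral_model n\<^esub> x =
      \<one>\<^bsub>dihedral_model n\<^esub>"
    using x xi by (auto simp: dihedral_model_def mod_simps)
  ultimately show "\<exists>y\<in>carrier (dihedral_model n).
      y \<otimes>\<^bsub>dihedral_model n\<^esub> x = \<one>\<^bsub>dihedral_model n\<^esub>"
    by blast
qed (use assms in \<open>auto simp: dihedral_model_def\<close>)

lemma dihedral_model_dihedral:
  assumes "n \<ge> 1"
  shows "dihedral_group n (dihedral_model n)"
proof -
  let ?G = "dihedral_model n"
  let ?a = "(1 mod int n, False)"
  let ?b = "(0 :: int, True)"
  interpret group ?G
    by (rule dihedral_model_group[OF assms])
  have a: "?a \<in> carrier ?G" and b: "?b \<in> carrier ?G"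
    using assms by (auto simp: dihedral_model_def)
  have pow_a: "?a [^]\<^bsub>?G\<^esub> k = (int k mod int n, False)" for k :: nat
    by (induction k) (auto simp: dihedral_model_def mod_simps algebra_simps)
  have b2: "?b \<otimes>\<^bsub>?G\<^esub> ?b = \<one>\<^bsub>?G\<^esub>"
    by (simp add: dihedral_model_def)
  have inv_b: "inv\<^bsub>?G\<^esub> ?b = ?b"
    using b b2 by (intro inv_equality) auto
  have "(?b \<otimes>\<^bsub>?G\<^esub> ?a \<otimes>\<^bsub>?G\<^esub> ?b) \<otimes>\<^bsub>?G\<^esub> ?a = \<one>\<^bsub>?G\<^esub>"
    by (simp add: dihedral_model_def mod_simps)
  then have conj: "?b \<otimes>\<^bsub>?G\<^esub> ?a \<otimes>\<^bsub>?G\<^esub> inv\<^bsub>?G\<^esub> ?b = inv\<^bsub>?G\<^esub> ?a"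
    using a b by (metis inv_b inv_equality m_closed)
  have gen_pow: "?a [^]\<^bsub>?G\<^esub> k \<in> generate ?G {?a, ?b}" for k :: nat
    by (induction k) (auto intro: generate.intros)
  have "carrier ?G \<subseteq> generate ?G {?a, ?b}"
  proof
    fix x
    assume x: "x \<in> carrier ?G"
    obtain i s where xi: "x = (i, s)"
      by (cases x)
    have i: "0 \<le> i" "i < int n"
      using x xi by (auto simp: dihedral_model_def)
    have rot: "?a [^]\<^bsub>?G\<^esub> nat i = (i, False)"
      using i by (simp add: pow_a)
    show "x \<in> generate ?G {?a, ?b}"
    proof (cases s)
      case False
      then show ?thesis
        using gen_pow[of "nat i"] rot xi by simp
    next
      case True
      have "?a [^]\<^bsub>?G\<^esub> nat i \<otimes>\<^bsub>?G\<^esub> ?b = x"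
        unfolding rot using i xi True by (simp add: dihedral_model_def)
      moreover have "?a [^]\<^bsub>?G\<^esub> nat i \<otimes>\<^bsub>?G\<^esub> ?b \<in> generate ?G {?a, ?b}"
        by (rule generate.eng[OF gen_pow]) (auto intro: generate.incl)
      ultimately show ?thesis
        by simp
    qed
  qed
  then have gen: "generate ?G {?a, ?b} = carrier ?G"
    using generate_incl[of "{?a, ?b}"] a b by blast
  have an: "?a [^]\<^bsub>?G\<^esub> n = \<one>\<^bsub>?G\<^esub>"
    unfolding pow_a by (simp add: dihedral_model_def)
  have bn: "?b [^]\<^bsub>?G\<^esub> (2::nat) = \<one>\<^bsub>?G\<^esub>"
    using b b2 by (simp add: numeral_2_eq_2)
  have "Coset.order ?G = 2 * n"
    by (simp add: Coset.order_def dihedral_model_def card_cartesian_product)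
  then show ?thesis
    unfolding dihedral_group_def using a b gen an bn conj is_group by blast
qed

section \<open>Planar graphs\<close>

text \<open>A graph is given by its vertex set and its set of edges, an edge being the set of its two ends.\<close>

type_synonym 'v graph = "'v set \<times> 'v set set"

text \<open>
  Planarity is drawability in the plane, modelled by \<^typ>\<open>complex\<close>: distinct vertices are distinct
  points, every edge is an arc between its ends, and the interior of an edge contains no vertex and
  no point of another edge.
\<close>

definition planar_graph :: "'v graph \<Rightarrow> bool" where
  "planar_graph = (\<lambda>(V, E).
     \<exists>(pos :: 'v \<Rightarrow> complex) (\<gamma> :: 'v set \<Rightarrow> real \<Rightarrow> complex).
       inj_on pos V \<and>
       (\<forall>e\<in>E. arc (\<gamma> e) \<and> {pathstart (\<gamma> e), pathfinish (\<gamma> e)} = pos ` e \<and>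
              (path_image (\<gamma> e) - pos ` e) \<inter> pos ` V = {}) \<and>
       (\<forall>e\<in>E. \<forall>f\<in>E. e \<noteq> f \<longrightarrow> (path_image (\<gamma> e) - pos ` e) \<inter> path_image (\<gamma> f) = {}))"

section \<open>Hypergraphs\<close>

type_synonym 'v hypergraph = "'v set \<times> 'v set set"

definition incidence_graph :: "'v hypergraph \<Rightarrow> ('v + 'v set) graph" where
  "incidence_graph = (\<lambda>(V, E). (V <+> E, {{Inl v, Inr e} |v e. v \<in> V \<and> e \<in> E \<and> v \<in> e}))"

definition planar_hypergraph :: "'v hypergraph \<Rightarrow> bool" where
  "planar_hypergraph H \<longleftrightarrow> planar_graph (incidence_graph H)"

section \<open>The co-maximal hypergraph of a group\<close>

definition nontrivial_proper_subgroups :: "('a, 'b) monoid_scheme \<Rightarrow> 'a set set" where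
  "nontrivial_proper_subgroups G = {H. subgroup H G \<and> H \<noteq> {\<one>\<^bsub>G\<^esub>} \<and> H \<noteq> carrier G}"

definition comaximal_vertices :: "('a, 'b) monoid_scheme \<Rightarrow> 'a set set" where
  "comaximal_vertices G =
     {H \<in> nontrivial_proper_subgroups G.
        \<exists>K\<in>nontrivial_proper_subgroups G. H <#>\<^bsub>G\<^esub> K = carrier G}"

definition comaximal_hyperedges :: "('a, 'b) monoid_scheme \<Rightarrow> 'a set set set" where
  "comaximal_hyperedges G =
     {E. E \<subseteq> comaximal_vertices G \<and>
         pairwise (\<lambda>H K. H <#>\<^bsub>G\<^esub> K = carrier G) E \<and>
         \<not> (\<exists>E'\<subseteq>comaximal_vertices G.
              E \<subset> E' \<and> pairwise (\<lambda>H K. H <#>\<^bsub>G\<^esub> K = carrier G) E')}"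

definition comaximal_hypergraph :: "('a, 'b) monoid_scheme \<Rightarrow> 'a set hypergraph" where
  "comaximal_hypergraph G = (comaximal_vertices G, comaximal_hyperedges G)"

end

theory Submission
  imports Defs "HOL-Analysis.Jordan_Curve"
begin

text \<open>
  Write the elements of \<open>D\<^sub>n\<close> as \<open>a\<^sup>k\<close> and \<open>a\<^sup>k b\<close>, and let \<open>H\<^bsub>d,i\<^esub> = \<langle>a\<^sup>d, a\<^sup>i b\<rangle>\<close> for \<open>d\<close> dividing \<open>n\<close>.

  If distinct primes \<open>p \<ge> 3\<close> and \<open>q\<close> divide \<open>n\<close>, then \<open>H\<^bsub>p,i\<^esub> H\<^bsub>q,j\<^esub> = D\<^sub>n\<close>, while \<open>H\<^bsub>p,i\<^esub>\<close> and \<open>H\<^bsub>p,j\<^esub>\<close> never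
  lie in a common hyperedge. For odd \<open>q\<close> the hyperedges through the pairs \<open>H\<^bsub>p,i\<^esub>, H\<^bsub>q,j\<^esub>\<close>
  subdivide a \<open>K\<^bsub>3,3\<^esub>\<close>. For \<open>q = 2\<close> the vertices \<open>\<langle>a\<rangle>\<close>, \<open>H\<^bsub>2,0\<^esub>\<close>, \<open>H\<^bsub>2,1\<^esub>\<close> and the hyperedges containing
  them together with \<open>H\<^bsub>p,j\<^esub>\<close>, \<open>j < 3\<close>, form a \<open>K\<^bsub>3,3\<^esub>\<close>.

  The graph \<open>K\<^bsub>3,3\<^esub>\<close> is not planar: removing a vertex leaves three arcs with common ends, and the removed
  vertex would be a point from which the interiors of all three arcs are accessible. The other
  component of the complement of two of the arcs then contradicts Janiszewski's theorem.

  If \<open>n\<close> is a power of \<open>p\<close>, a proper subgroup other than \<open>\<langle>a\<rangle>\<close> has all its rotations in \<open>\<langle>a\<^sup>p\<rangle>\<close>. Hence two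
  such subgroups have product \<open>D\<^sub>n\<close> only if \<open>p = 2\<close>, and then one of them is \<open>H\<^bsub>2,0\<^esub>\<close> or \<open>H\<^bsub>2,1\<^esub>\<close>. So, apart from
  \<open>\<langle>a\<rangle>\<close>, \<open>H\<^bsub>2,0\<^esub>\<close> and \<open>H\<^bsub>2,1\<^esub>\<close>, every vertex lies in a single hyperedge and no hyperedge contains two such
  vertices; this is simple enough to be drawn with straight segments.
\<close>

section \<open>Nonplanarity of the complete bipartite graph on three and three vertices\<close>

text \<open>A theta curve has three faces, each bounded by only two of its arcs, so no point
  \<open>z\<close> off the curve can reach all three arcs without crossing. Rather than determining
  the faces, the proof combines the Jordan curve theorem for \<open>c1\<close> and \<open>c2\<close>
  with Janiszewski's theorem for \<open>c2 \<union> c3\<close> and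
  \<open>c1 \<union> c3\<close>.\<close>

lemma arc_theta_no_common_face:
  fixes c1 c2 c3 :: "real \<Rightarrow> complex"
  assumes arcs: "arc c1" "arc c2" "arc c3"
    and starts: "pathstart c1 = u" "pathstart c2 = u" "pathstart c3 = u"
    and finishes: "pathfinish c1 = v" "pathfinish c2 = v" "pathfinish c3 = v"
    and inter: "path_image c1 \<inter> path_image c2 \<subseteq> {u, v}" "path_image c1 \<inter> path_image c3 \<subseteq> {u, v}"
      "path_image c2 \<inter> path_image c3 \<subseteq> {u, v}"
    and conn: "connected T1" "connected T2" "connected T3"
    and z: "z \<in> T1" "z \<in> T2" "z \<in> T3"
    and T: "T1 \<inter> (path_image c1 \<union> path_image c2 \<union> path_image c3) = {x1}"
      "T2 \<inter> (path_image c1 \<union> path_image c2 \<union> path_image c3) = {x2}"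
      "T3 \<inter> (path_image c1 \<union> path_image c2 \<union> path_image c3) = {x3}"
    and x: "x1 \<in> path_image c1 - {u, v}" "x2 \<in> path_image c2 - {u, v}" "x3 \<in> path_image c3 - {u, v}"
  shows False
proof -
  let ?C = "path_image (c1 +++ reversepath c2)"
  let ?P1 = "path_image c1" and ?P2 = "path_image c2" and ?P3 = "path_image c3"
  have simple: "simple_path (c1 +++ reversepath c2)"
    using arcs starts finishes inter by (intro simple_path_join_loop) (auto simp: arc_reversepath)
  have loop: "pathfinish (c1 +++ reversepath c2) = pathstart (c1 +++ reversepath c2)"
    using starts by simp
  have C: "?C = ?P1 \<union> ?P2"
    using finishes by (simp add: path_image_join)
  have uv: "u \<in> ?P1" "v \<in> ?P1" "u \<in> ?P2" "v \<in> ?P2" "u \<in> ?P3" "v \<in> ?P3"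
    using starts finishes pathstart_in_path_image pathfinish_in_path_image by metis+
  have xT: "x1 \<in> T1" "x2 \<in> T2" "x3 \<in> T3"
    using T by blast+
  have xC: "x1 \<in> ?C" "x2 \<in> ?C"
    using x C by blast+
  have ne: "x1 \<noteq> x2"
    using x inter by auto
  have zP: "z \<notin> ?P1 \<union> ?P2 \<union> ?P3"
    using z T ne by (metis Int_iff singletonD)
  txt \<open>\<open>W\<close> is the component of the complement of the closed curve \<open>c1 \<union> c2\<close> that does not contain \<open>z\<close>.
    It also misses \<open>c3\<close>, so its points are connected to \<open>z\<close> off \<open>c2 \<union> c3\<close> and off \<open>c1 \<union> c3\<close>.\<close>
  obtain W Z where WZ: "open W" "connected W" "W \<noteq> {}" "open Z" "z \<in> Z" "W \<inter> Z = {}" "W \<union> Z = - ?C"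
    "frontier W = ?C"
  proof -
    obtain inner outer where j: "inner \<noteq> {}" "open inner" "connected inner"
        "outer \<noteq> {}" "open outer" "connected outer" "inner \<inter> outer = {}"
        "inner \<union> outer = - ?C" "frontier inner = ?C" "frontier outer = ?C"
      using Jordan_curve[OF simple loop] by metis
    consider "z \<in> inner" | "z \<in> outer"
      using j(8) zP C by auto
    then show thesis
    proof cases
      case 1
      then show ?thesis using j by (intro that[of outer inner]) auto
    next
      case 2
      then show ?thesis using j by (intro that[of inner outer]) auto
    qed
  qed
  have in_Z: "S \<inter> W = {}" if "connected S" "z \<in> S" "S \<inter> ?C = {}" for S
    using connectedD[OF that(1) WZ(1,4)] that WZ by blast
  let ?O3 = "?P3 - {u, v}"
  have "connected ?O3"
    using connected_simple_path_endless[OF arc_imp_simple_path[OF arcs(3)]] starts finishes by simp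
  moreover have "x3 \<in> ?O3 \<inter> T3"
    using x(3) T(3) by auto
  ultimately have "connected (?O3 \<union> T3)"
    using conn(3) by (intro connected_Un) auto
  moreover have "x3 \<notin> ?P1 \<union> ?P2"
    using x(3) inter by auto
  then have "(?O3 \<union> T3) \<inter> ?C = {}"
    using T(3) inter C by auto
  ultimately have "(?O3 \<union> T3) \<inter> W = {}"
    using z by (intro in_Z) auto
  moreover have WC: "W \<inter> ?C = {}"
    using WZ(7) by blast
  ultimately have W3: "W \<inter> (?P1 \<union> ?P2 \<union> ?P3) = {}"
    using C uv by auto
  obtain w where w: "w \<in> W"
    using WZ(3) by auto
  \<comment> \<open>Since \<open>frontier W\<close> is the whole closed curve, \<open>W\<close>
    stays connected after adding one curve point \<open>y\<close>, and \<open>T'\<close> leads from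
    \<open>y\<close> on to \<open>z\<close>.\<close>
  have reach: "connected_component (- S) w z"
    if "connected T'" "z \<in> T'" "y \<in> T'" "y \<in> ?C" "T' \<inter> S = {}" "S \<subseteq> ?P1 \<union> ?P2 \<union> ?P3" for T' y S
  proof -
    have "y \<in> closure W"
      using that(4) WZ(8) unfolding frontier_def by blast
    then have "connected (insert y W)"
      using WZ(2) closure_subset[of W] connected_intermediate_closure[of W "insert y W"]
      by (metis insert_subset subset_insertI)
    then have "connected (insert y W \<union> T')"
      using that by (intro connected_Un) auto
    moreover have "insert y W \<union> T' \<subseteq> - S"
      using that W3 by auto
    ultimately show ?thesis
      unfolding connected_component_def using w that by blast
  qed
  have "x1 \<notin> ?P2 \<union> ?P3"
    using x(1) inter(1,2) by blast
  then have T1: "T1 \<inter> (?P2 \<union> ?P3) = {}"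
    using T(1) by (auto simp: set_eq_iff)
  have "x2 \<notin> ?P1 \<union> ?P3"
    using x(2) inter(1,3) by blast
  then have T2: "T2 \<inter> (?P1 \<union> ?P3) = {}"
    using T(2) by (auto simp: set_eq_iff)
  have c1: "connected_component (- (?P2 \<union> ?P3)) w z"
    by (rule reach[OF conn(1) z(1) xT(1) xC(1) T1]) blast
  have c2: "connected_component (- (?P1 \<union> ?P3)) w z"
    by (rule reach[OF conn(2) z(2) xT(2) xC(2) T2]) blast
  \<comment> \<open>The two sets share only \<open>c3\<close>, as \<open>c1\<close> and
    \<open>c2\<close> meet just at its ends; Janiszewski's theorem asks for this intersection to be
    connected.\<close>
  have "(?P2 \<union> ?P3) \<inter> (?P1 \<union> ?P3) = ?P3"
    using inter uv by auto
  then have "connected ((?P2 \<union> ?P3) \<inter> (?P1 \<union> ?P3))"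
    using arcs(3) by (simp add: arc_imp_path connected_path_image)
  then have "connected_component (- ((?P2 \<union> ?P3) \<union> (?P1 \<union> ?P3))) w z"
    using arcs by (intro Janiszewski c1 c2)
      (auto simp: arc_imp_path intro!: compact_Un closed_Un compact_path_image closed_path_image)
  then obtain S where S: "connected S" "S \<subseteq> - ((?P2 \<union> ?P3) \<union> (?P1 \<union> ?P3))" "w \<in> S" "z \<in> S"
    unfolding connected_component_def by auto
  then have "S \<inter> W = {}"
    using C by (intro in_Z) auto
  then show False
    using S w by auto
qed

text \<open>The arcs \<open>c i\<close> from \<open>b 0\<close> through \<open>a i\<close> to
  \<open>b 1\<close> form a theta curve. The remaining arcs \<open>g i 2\<close> lead from the
  common point \<open>b 2\<close> to the inner points \<open>a i\<close> and touch the curve nowhere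
  else.\<close>

lemma arc_K33_False:
  fixes a b :: "nat \<Rightarrow> complex" and g :: "nat \<Rightarrow> nat \<Rightarrow> real \<Rightarrow> complex"
  assumes g: "\<And>i j. i < 3 \<Longrightarrow> j < 3 \<Longrightarrow> arc (g i j) \<and> pathstart (g i j) = a i \<and> pathfinish (g i j) = b j"
    and disj: "\<And>i j k l. i < 3 \<Longrightarrow> j < 3 \<Longrightarrow> k < 3 \<Longrightarrow> l < 3 \<Longrightarrow> (i, j) \<noteq> (k, l) \<Longrightarrow>
      path_image (g i j) \<inter> path_image (g k l) \<subseteq> (if i = k then {a i} else {}) \<union> (if j = l then {b j} else {})"
  shows False
proof -
  define c where "c i = reversepath (g i 0) +++ g i 1" for i
  have ends: "a i \<in> path_image (g i j)" "b j \<in> path_image (g i j)" if "i < 3" "j < 3" for i j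
    using g[OF that] pathstart_in_path_image pathfinish_in_path_image by metis+
  have ab: "a i \<noteq> b j" if "i < 3" "j < 3" for i j
    using g[OF that] arc_distinct_ends by metis
  have arc_c: "arc (c i) \<and> pathstart (c i) = b 0 \<and> pathfinish (c i) = b 1" if "i < 3" for i
    unfolding c_def using g[of i 0] g[of i 1] disj[of i 0 i 1] that
    by (auto intro!: arc_join simp: arc_reversepath)
  have im_c: "path_image (c i) = path_image (g i 0) \<union> path_image (g i 1)" if "i < 3" for i
    unfolding c_def using g[of i 0] g[of i 1] that by (subst path_image_join) auto
  have inter_c: "path_image (c i) \<inter> path_image (c k) \<subseteq> {b 0, b 1}" if "i < 3" "k < 3" "i \<noteq> k" for i k
    using disj[of i 0 k 0] disj[of i 0 k 1] disj[of i 1 k 0] disj[of i 1 k 1] that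
    unfolding im_c[OF that(1)] im_c[OF that(2)] by auto
  have a_c: "a i \<in> path_image (c i) - {b 0, b 1}" if "i < 3" for i
    using ends(1)[of i 0] im_c[of i] that ab[of i 0] ab[of i 1] by auto
  have T: "path_image (g i 2) \<inter> (path_image (c 0) \<union> path_image (c 1) \<union> path_image (c 2)) = {a i}"
    if i: "i < 3" for i
  proof -
    have sub: "path_image (g i 2) \<inter> path_image (c k) \<subseteq> {a i}" if "k < 3" for k
      using disj[of i 2 k 0] disj[of i 2 k 1] that i im_c[of k] by (auto split: if_splits)
    have "i = 0 \<or> i = 1 \<or> i = 2"
      using i by linarith
    then have "a i \<in> path_image (c 0) \<union> path_image (c 1) \<union> path_image (c 2)"
      using a_c[OF i] by auto
    moreover have "a i \<in> path_image (g i 2)"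
      using ends(1) i by simp
    ultimately show ?thesis
      using sub[of 0] sub[of 1] sub[of 2] by (simp add: Int_Un_distrib) blast
  qed
  have conn: "connected (path_image (g i 2))" "b 2 \<in> path_image (g i 2)" if "i < 3" for i
    using g[of i 2] ends(2)[of i 2] that by (auto intro: connected_path_image arc_imp_path)
  show False
  proof (rule arc_theta_no_common_face[of "c 0" "c 1" "c 2" "b 0" "b 1"
        "path_image (g 0 2)" "path_image (g 1 2)" "path_image (g 2 2)" "b 2" "a 0" "a 1" "a 2"])
    show "path_image (c 0) \<inter> path_image (c 1) \<subseteq> {b 0, b 1}"
      "path_image (c 0) \<inter> path_image (c 2) \<subseteq> {b 0, b 1}"
      "path_image (c 1) \<inter> path_image (c 2) \<subseteq> {b 0, b 1}"
      by (rule inter_c; simp)+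
    show "a 0 \<in> path_image (c 0) - {b 0, b 1}" "a 1 \<in> path_image (c 1) - {b 0, b 1}"
      "a 2 \<in> path_image (c 2) - {b 0, b 1}"
      by (rule a_c; simp)+
  qed (simp_all add: arc_c conn T[simplified One_nat_def])
qed

section \<open>From arcs in the plane to drawings of graphs\<close>

lemma planar_graphE:
  assumes planar: "planar_graph (V, E)" and E: "\<Union>E \<subseteq> V"
  obtains pos :: "'v \<Rightarrow> complex" and P :: "'v \<Rightarrow> 'v \<Rightarrow> real \<Rightarrow> complex"
  where "inj_on pos V"
    and "\<And>u v. {u, v} \<in> E \<Longrightarrow> arc (P u v) \<and> pathstart (P u v) = pos u \<and> pathfinish (P u v) = pos v"
    and "\<And>u v u' v'. {u, v} \<in> E \<Longrightarrow> {u', v'} \<in> E \<Longrightarrow> {u, v} \<noteq> {u', v'} \<Longrightarrow>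
      path_image (P u v) \<inter> path_image (P u' v') \<subseteq> pos ` ({u, v} \<inter> {u', v'})"
proof -
  obtain pos and \<gamma> :: "'v set \<Rightarrow> real \<Rightarrow> complex" where inj: "inj_on pos V"
    and arcs: "\<And>e. e \<in> E \<Longrightarrow> arc (\<gamma> e) \<and> {pathstart (\<gamma> e), pathfinish (\<gamma> e)} = pos ` e"
    and disj: "\<And>e f. e \<in> E \<Longrightarrow> f \<in> E \<Longrightarrow> e \<noteq> f \<Longrightarrow> (path_image (\<gamma> e) - pos ` e) \<inter> path_image (\<gamma> f) = {}"
    using planar unfolding planar_graph_def prod.case by metis
  \<comment> \<open>The arc drawn for an edge has no prescribed direction; it is reversed when
    needed to run from \<open>u\<close> to \<open>v\<close>.\<close>
  define P where "P u v = (if pathstart (\<gamma> {u, v}) = pos u then \<gamma> {u, v} else reversepath (\<gamma> {u, v}))" for u v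
  have im: "path_image (P u v) = path_image (\<gamma> {u, v})" for u v
    by (simp add: P_def)
  show thesis
  proof (rule that[OF inj, of P])
    fix u v
    assume "{u, v} \<in> E"
    then have "arc (\<gamma> {u, v})" "{pathstart (\<gamma> {u, v}), pathfinish (\<gamma> {u, v})} = {pos u, pos v}"
      using arcs[of "{u, v}"] by auto
    then show "arc (P u v) \<and> pathstart (P u v) = pos u \<and> pathfinish (P u v) = pos v"
      using arc_distinct_ends[of "\<gamma> {u, v}"] by (auto simp: P_def arc_reversepath doubleton_eq_iff)
  next
    fix u v u' v'
    assume *: "{u, v} \<in> E" "{u', v'} \<in> E" "{u, v} \<noteq> {u', v'}"
    have "path_image (P u v) \<inter> path_image (P u' v') \<subseteq> pos ` {u, v} \<inter> pos ` {u', v'}"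
      unfolding im using disj[OF *] disj[OF *(2,1)] *(3) by blast
    \<comment> \<open>Injectivity of \<open>pos\<close>, which applies because all ends lie in
      \<open>V\<close>, identifies common end points with common vertices.\<close>
    also have "\<dots> = pos ` ({u, v} \<inter> {u', v'})"
      using inj * E by (intro inj_on_image_Int[symmetric]) auto
    finally show "path_image (P u v) \<inter> path_image (P u' v') \<subseteq> pos ` ({u, v} \<inter> {u', v'})" .
  qed
qed

lemma K33_not_planar:
  fixes a b :: "nat \<Rightarrow> 'v"
  assumes E: "\<Union>E \<subseteq> V"
    and inj: "inj_on a {..<3}" "inj_on b {..<3}" "\<And>i j. i < 3 \<Longrightarrow> j < 3 \<Longrightarrow> a i \<noteq> b j"
    and edge: "\<And>i j. i < 3 \<Longrightarrow> j < 3 \<Longrightarrow> {a i, b j} \<in> E"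
  shows "\<not> planar_graph (V, E)"
proof
  assume "planar_graph (V, E)"
  then obtain pos :: "'v \<Rightarrow> complex" and P where P:
    "\<And>u v. {u, v} \<in> E \<Longrightarrow> arc (P u v) \<and> pathstart (P u v) = pos u \<and> pathfinish (P u v) = pos v"
    "\<And>u v u' v'. {u, v} \<in> E \<Longrightarrow> {u', v'} \<in> E \<Longrightarrow> {u, v} \<noteq> {u', v'} \<Longrightarrow>
      path_image (P u v) \<inter> path_image (P u' v') \<subseteq> pos ` ({u, v} \<inter> {u', v'})"
    using E by (rule planar_graphE) blast
  have eq: "a i = a k \<longleftrightarrow> i = k" "b i = b k \<longleftrightarrow> i = k" if "i < 3" "k < 3" for i k
    using inj that by (auto simp: inj_on_def)
  show False
  proof (rule arc_K33_False[of "\<lambda>i j. P (a i) (b j)" "pos \<circ> a" "pos \<circ> b"], goal_cases)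
    case (1 i j)
    then show ?case
      using P(1)[OF edge] by auto
  next
    case (2 i j k l)
    then have "a i \<noteq> b l" "a k \<noteq> b j" "a i = a k \<longleftrightarrow> i = k" "b j = b l \<longleftrightarrow> j = l"
      using inj(3) eq by auto
    moreover from this have "{a i, b j} \<noteq> {a k, b l}"
      using 2 by (auto simp: doubleton_eq_iff)
    ultimately show ?case
      using P(2)[of "a i" "b j" "a k" "b l"] edge 2 by auto
  qed
qed

text \<open>The two arcs meeting in \<open>s i j\<close> join to an arc from \<open>a i\<close> to
  \<open>b j\<close>. As the \<open>s i j\<close> differ from each other and from the branch
  vertices, the joined arcs meet only at common ends.\<close>

lemma subdivided_K33_not_planar:
  fixes a b :: "nat \<Rightarrow> 'v" and s :: "nat \<Rightarrow> nat \<Rightarrow> 'v"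
  assumes E: "\<Union>E \<subseteq> V"
    and inj: "inj_on a {..<3}" "inj_on b {..<3}" "\<And>i j. i < 3 \<Longrightarrow> j < 3 \<Longrightarrow> a i \<noteq> b j"
      "\<And>i j k l. i < 3 \<Longrightarrow> j < 3 \<Longrightarrow> k < 3 \<Longrightarrow> l < 3 \<Longrightarrow> s i j = s k l \<Longrightarrow> i = k \<and> j = l"
      "\<And>i j k. i < 3 \<Longrightarrow> j < 3 \<Longrightarrow> k < 3 \<Longrightarrow> s i j \<noteq> a k \<and> s i j \<noteq> b k"
    and edge: "\<And>i j. i < 3 \<Longrightarrow> j < 3 \<Longrightarrow> {a i, s i j} \<in> E \<and> {s i j, b j} \<in> E"
  shows "\<not> planar_graph (V, E)"
proof
  assume "planar_graph (V, E)"
  then obtain pos :: "'v \<Rightarrow> complex" and P where pos: "inj_on pos V" and P: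
    "\<And>u v. {u, v} \<in> E \<Longrightarrow> arc (P u v) \<and> pathstart (P u v) = pos u \<and> pathfinish (P u v) = pos v"
    "\<And>u v u' v'. {u, v} \<in> E \<Longrightarrow> {u', v'} \<in> E \<Longrightarrow> {u, v} \<noteq> {u', v'} \<Longrightarrow>
      path_image (P u v) \<inter> path_image (P u' v') \<subseteq> pos ` ({u, v} \<inter> {u', v'})"
    using E by (rule planar_graphE) blast
  have eq: "a i = a k \<longleftrightarrow> i = k" "b i = b k \<longleftrightarrow> i = k" if "i < 3" "k < 3" for i k
    using inj that by (auto simp: inj_on_def)
  define g where "g i j = P (a i) (s i j) +++ P (s i j) (b j)" for i j
  have im: "path_image (g i j) = path_image (P (a i) (s i j)) \<union> path_image (P (s i j) (b j))"
    if "i < 3" "j < 3" for i j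
    unfolding g_def using P(1) edge[OF that] by (subst path_image_join) auto
  show False
  proof (rule arc_K33_False[of g "pos \<circ> a" "pos \<circ> b"], goal_cases)
    case (1 i j)
    have "path_image (P (a i) (s i j)) \<inter> path_image (P (s i j) (b j)) \<subseteq> {pos (s i j)}"
      using P(2)[of "a i" "s i j" "s i j" "b j"] edge[OF 1] inj(3)[OF 1] inj(5)[of i j j] 1
      by (auto simp: doubleton_eq_iff)
    then show ?case
      using P(1)[of "a i" "s i j"] P(1)[of "s i j" "b j"] edge[OF 1]
      by (auto simp: g_def intro!: arc_join)
  next
    case (2 i j k l)
    have ne: "a i \<noteq> b l" "a k \<noteq> b j" "a i = a k \<longleftrightarrow> i = k" "b j = b l \<longleftrightarrow> j = l"
      "s i j \<noteq> s k l" "s i j \<noteq> a k" "s i j \<noteq> b l" "s k l \<noteq> a i" "s k l \<noteq> b j"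
      using 2 inj(3) eq inj(4)[of i j k l] inj(5) by (auto dest: sym)
    have e: "{a i, s i j} \<in> E" "{s i j, b j} \<in> E" "{a k, s k l} \<in> E" "{s k l, b l} \<in> E"
      using edge 2 by auto
    have "path_image (P (a i) (s i j)) \<inter> path_image (P (a k) (s k l)) \<subseteq> pos ` ({a i} \<inter> {a k})"
      "path_image (P (a i) (s i j)) \<inter> path_image (P (s k l) (b l)) \<subseteq> {}"
      "path_image (P (s i j) (b j)) \<inter> path_image (P (a k) (s k l)) \<subseteq> {}"
      "path_image (P (s i j) (b j)) \<inter> path_image (P (s k l) (b l)) \<subseteq> pos ` ({b j} \<inter> {b l})"
      using P(2)[OF e(1,3)] P(2)[OF e(1,4)] P(2)[OF e(2,3)] P(2)[OF e(2,4)] ne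
      by (auto simp: doubleton_eq_iff)
    then show ?case
      unfolding im[OF 2(1,2)] im[OF 2(3,4)] using ne(3,4) by (auto split: if_splits)
  qed
qed

section \<open>A straight-line drawing\<close>

text \<open>In the application \<open>r\<close> is the rotation subgroup, and \<open>x\<close>,
  \<open>y\<close> are the two dihedral subgroups of index 2 or placeholders. By
  \<open>covered\<close> and \<open>pendant\<close> every other vertex is a leaf of the incidence
  graph; \<open>single\<close> gives each hyperedge at most one leaf.\<close>

lemma star_like_hypergraph_planar:
  fixes V :: "'v set" and E :: "'v set set"
  assumes fin: "finite E" and E: "\<Union>E \<subseteq> V" and xyr: "x \<noteq> y" "x \<noteq> r" "y \<noteq> r"
    and covered: "\<And>v. v \<in> V \<Longrightarrow> v \<notin> {r, x, y} \<Longrightarrow> \<exists>e\<in>E. v \<in> e"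
    and pendant: "\<And>v e f. v \<notin> {r, x, y} \<Longrightarrow> e \<in> E \<Longrightarrow> f \<in> E \<Longrightarrow> v \<in> e \<Longrightarrow> v \<in> f \<Longrightarrow> e = f"
    and single: "\<And>e v w. e \<in> E \<Longrightarrow> v \<in> e - {r, x, y} \<Longrightarrow> w \<in> e - {r, x, y} \<Longrightarrow> v = w"
    and common: "\<And>e f. e \<in> E \<Longrightarrow> f \<in> E \<Longrightarrow> {x, y} \<subseteq> e \<Longrightarrow> {x, y} \<subseteq> f \<Longrightarrow> e = f"
  shows "planar_hypergraph (V, E)"
proof -
  txt \<open>Hyperedges become integer points \<open>t e\<close> of the real axis, \<open>r\<close> becomes \<open>i\<close>, and \<open>x\<close>, \<open>y\<close> become \<open>\<plusminus>1 - i\<close>.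
    The sign of \<open>t e\<close> keeps the edges at \<open>x\<close> apart from those at \<open>y\<close>. Every other vertex sits at
    distance \<open>1 / 2\<close> to the right of its only hyperedge.\<close>
  obtain N :: "'v set \<Rightarrow> nat" where N: "inj_on N E"
    using fin finite_imp_inj_to_nat_seg by metis
  define t :: "'v set \<Rightarrow> int" where
    "t e = (if {x, y} \<subseteq> e then 0 else if y \<in> e then - int (N e) - 1 else int (N e) + 1)" for e
  define T where "T e = real_of_int (t e)" for e
  have T_inj: "e = f" if "e \<in> E" "f \<in> E" "\<bar>T e - T f\<bar> < 1" for e f
  proof -
    have "t e = t f"
      using that(3) by (simp add: T_def)
    then show ?thesis
      using common[OF that(1,2)] N that(1,2) by (auto simp: t_def inj_on_def split: if_splits)
  qed
  \<comment> \<open>\<open>T\<close> takes integer values, so a leaf at \<open>T f + 1 / 2\<close>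
    is never closer than 1/2 to a hyperedge point.\<close>
  have T_half: "\<bar>T e - T f - 1 / 2\<bar> \<ge> 1 / 2" for e f
  proof -
    have "t e \<le> t f \<or> t f + 1 \<le> t e"
      by linarith
    then have "T e \<le> T f \<or> T f + 1 \<le> T e"
      unfolding T_def by (metis of_int_1 of_int_add of_int_le_iff)
    then show ?thesis
      by linarith
  qed
  have Tx: "T e \<ge> 0" if "x \<in> e" for e
    using that by (simp add: T_def t_def)
  have Ty: "T e \<le> 0" if "y \<in> e" for e
    using that by (simp add: T_def t_def)
  define home where "home v = (SOME e. e \<in> E \<and> v \<in> e)" for v
  have home: "home v \<in> E \<and> v \<in> home v" if "v \<in> V" "v \<notin> {r, x, y}" for v
    unfolding home_def using covered[OF that] by (metis (mono_tags, lifting) someI_ex)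
  define P :: "'v \<Rightarrow> complex" where "P v = (if v = r then Complex 0 1 else if v = x then Complex 1 (- 1)
    else if v = y then Complex (- 1) (- 1) else Complex (T (home v) + 1 / 2) 0)" for v
  define Q :: "'v set \<Rightarrow> complex" where "Q e = Complex (T e) 0" for e
  have P_simps: "P r = Complex 0 1" "P x = Complex 1 (- 1)" "P y = Complex (- 1) (- 1)"
    using xyr by (auto simp: P_def)
  have P_pendant: "P v = Complex (T (home v) + 1 / 2) 0" if "v \<notin> {r, x, y}" for v
    using that by (auto simp: P_def)
  have home_eq: "home v = e" if "e \<in> E" "v \<in> e" "v \<notin> {r, x, y}" for v e
    using pendant[of v "home v" e] home[of v] that E by auto
  have kinds: "v = r \<or> v = x \<and> T e \<ge> 0 \<or> v = y \<and> T e \<le> 0 \<or> v \<notin> {r, x, y} \<and> home v = e"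
    if "e \<in> E" "v \<in> e" for v e
    using home_eq[OF that] Tx[of e] Ty[of e] that(2) by auto
  have cases: "v = r \<or> v = x \<or> v = y \<or> v \<notin> {r, x, y}" for v
    by auto
  have Q_inj: "e = f" if "e \<in> E" "f \<in> E" "Q e = Q f" for e f
    using that T_inj[of e f] by (simp add: Q_def)
  have PQ: "P v \<noteq> Q e" for v e
    using cases[of v] T_half[of e "home v"] P_pendant[of v] by (auto simp: Q_def P_simps)
  have P_inj: "v = w" if "v \<in> V" "w \<in> V" "P v = P w" for v w
  proof -
    have "v = w" if "v \<notin> {r, x, y}" "w \<notin> {r, x, y}"
    proof -
      have "home v = home w"
        using \<open>P v = P w\<close> T_inj[of "home v" "home w"] home[of v] home[of w] that \<open>v \<in> V\<close> \<open>w \<in> V\<close>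
        by (simp add: P_pendant)
      then show ?thesis
        using single[of "home v" v w] home[of v] home[of w] that \<open>v \<in> V\<close> \<open>w \<in> V\<close> by auto
    qed
    then show ?thesis
      using cases[of v] cases[of w] P_pendant[of v] P_pendant[of w] \<open>P v = P w\<close>
      by (auto simp: P_simps)
  qed
  have seg: "z = P v \<or> z = Q e \<or> (\<exists>h. 0 < h \<and> h < 1 \<and> z = (1 - h) *\<^sub>R P v + h *\<^sub>R Q e)"
    if "z \<in> closed_segment (P v) (Q e)" for z v e
    using that by (force simp: closed_segment_def less_le)
  have avoid_P: "z \<noteq> P w"
    if "e \<in> E" "v \<in> e" "0 < h" "h < 1" "z = (1 - h) *\<^sub>R P v + h *\<^sub>R Q e" "w \<in> V" for e v h z w
    using kinds[OF that(1,2)] cases[of w] P_pendant[of v] P_pendant[of w] that T_half[of e "home w"]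
    by (auto simp: P_simps Q_def complex_eq_iff algebra_simps)
  have avoid_Q: "z \<noteq> Q f"
    if "e \<in> E" "v \<in> e" "0 < h" "h < 1" "z = (1 - h) *\<^sub>R P v + h *\<^sub>R Q e" "f \<in> E" for e v h z f
    using kinds[OF that(1,2)] P_pendant[of v] that T_half[of f e]
    by (auto simp: P_simps Q_def complex_eq_iff algebra_simps)
  have cross: "v = w \<and> e = f"
    if e: "e \<in> E" "v \<in> e" "f \<in> E" "w \<in> f" and h: "0 < h" "h < 1" "0 < k" "k < 1"
      and z: "(1 - h) *\<^sub>R P v + h *\<^sub>R Q e = (1 - k) *\<^sub>R P w + k *\<^sub>R Q f" for e f v w h k
  proof -
    let ?kind = "\<lambda>v e. v = r \<or> v = x \<and> T e \<ge> 0 \<or> v = y \<and> T e \<le> 0 \<or> v \<notin> {r, x, y} \<and> home v = e"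
    have kind: "?kind v e" "?kind w f"
      using kinds e by blast+
    have zz: "(1 - h) * Re (P v) + h * T e = (1 - k) * Re (P w) + k * T f"
      "(1 - h) * Im (P v) = (1 - k) * Im (P w)"
      using z by (auto simp: complex_eq_iff Q_def)
    have eq: "e = f" if "h = k" "h * T e = h * T f"
      using T_inj[OF e(1,3)] that h by simp
    \<comment> \<open>Heights are positive on segments from \<open>r\<close>, negative on those from
      \<open>x\<close> or \<open>y\<close>, and zero on those from leaves, so only these
      combinations can cross. In cases 4 and 5 equal heights give \<open>h = k\<close>, and the two
      points then lie on opposite sides of the imaginary axis.\<close>
    consider "v = r" "w = r" | "v = x" "w = x" | "v = y" "w = y"
      | "v = x" "w = y" "T e \<ge> 0" "T f \<le> 0" | "v = y" "w = x" "T e \<le> 0" "T f \<ge> 0"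
      | "v \<notin> {r, x, y}" "w \<notin> {r, x, y}" "home v = e" "home w = f"
      using kind zz(2) h P_pendant[of v] P_pendant[of w] by (auto simp: P_simps)
    then show ?thesis
    proof cases
      case 4
      then have "h = k" "(1 - h) + h * T e = - (1 - k) + k * T f"
        using zz by (simp_all add: P_simps)
      moreover have "0 \<le> h * T e" "k * T f \<le> 0"
        using 4 h by (simp_all add: mult_nonneg_nonneg mult_nonneg_nonpos)
      ultimately show ?thesis
        using h by linarith
    next
      case 5
      then have "h = k" "- (1 - h) + h * T e = (1 - k) + k * T f"
        using zz by (simp_all add: P_simps)
      moreover have "h * T e \<le> 0" "0 \<le> k * T f"
        using 5 h by (simp_all add: mult_nonneg_nonneg mult_nonneg_nonpos)
      ultimately show ?thesis
        using h by linarith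
    next
      case 6
      have "T e + (1 - h) / 2 = T f + (1 - k) / 2"
        using zz(1) 6 P_pendant[of v] P_pendant[of w] by (simp add: field_simps)
      then have "\<bar>T e - T f\<bar> < 1"
        using h by (auto simp: abs_less_iff field_simps)
      then have "e = f"
        using T_inj[OF e(1,3)] by simp
      then show ?thesis
        using single[of e v w] 6 e by auto
    qed (use zz h eq in \<open>auto simp: P_simps\<close>)
  qed
  define pos :: "'v + 'v set \<Rightarrow> complex" where "pos = case_sum P Q"
  define \<gamma> :: "('v + 'v set) set \<Rightarrow> real \<Rightarrow> complex"
    where "\<gamma> \<epsilon> = linepath (P (THE v. Inl v \<in> \<epsilon>)) (Q (THE e. Inr e \<in> \<epsilon>))" for \<epsilon>
  have \<gamma>: "\<gamma> {Inl v, Inr e} = linepath (P v) (Q e)" for v e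
    by (simp add: \<gamma>_def)
  have sub: "closed_segment (P v) (Q e) \<inter> closed_segment (P w) (Q f) \<subseteq> {P v, Q e}"
    if "e \<in> E" "v \<in> e" "f \<in> E" "w \<in> f" "(v, e) \<noteq> (w, f)" for v e w f
  proof
    fix z
    assume "z \<in> closed_segment (P v) (Q e) \<inter> closed_segment (P w) (Q f)"
    then show "z \<in> {P v, Q e}"
      using seg[of z v e] seg[of z w f] avoid_P[OF that(1,2), of _ z w] avoid_Q[OF that(1,2), of _ z f]
        cross[OF that(1-4)] that E by blast
  qed
  show ?thesis
    unfolding planar_hypergraph_def incidence_graph_def planar_graph_def prod.case
  proof (intro exI conjI ballI impI)
    show "inj_on pos (V <+> E)"
      by (auto simp: inj_on_def pos_def PQ PQ[symmetric] dest: P_inj Q_inj)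
  next
    fix \<epsilon>
    assume "\<epsilon> \<in> {{Inl v, Inr e} |v e. v \<in> V \<and> e \<in> E \<and> v \<in> e}"
    then obtain v e where ve: "\<epsilon> = {Inl v, Inr e}" "v \<in> V" "e \<in> E" "v \<in> e"
      by auto
    show "arc (\<gamma> \<epsilon>)" "{pathstart (\<gamma> \<epsilon>), pathfinish (\<gamma> \<epsilon>)} = pos ` \<epsilon>"
      by (auto simp: ve \<gamma> PQ pos_def intro!: arc_linepath)
    show "(path_image (\<gamma> \<epsilon>) - pos ` \<epsilon>) \<inter> pos ` (V <+> E) = {}"
      using seg[of _ v e] avoid_P[OF ve(3,4)] avoid_Q[OF ve(3,4)]
      by (fastforce simp: ve \<gamma> pos_def)
  next
    fix \<epsilon> \<phi>
    assume "\<epsilon> \<in> {{Inl v, Inr e} |v e. v \<in> V \<and> e \<in> E \<and> v \<in> e}"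
      "\<phi> \<in> {{Inl v, Inr e} |v e. v \<in> V \<and> e \<in> E \<and> v \<in> e}" "\<epsilon> \<noteq> \<phi>"
    then obtain v e w f where ve: "\<epsilon> = {Inl v, Inr e}" "e \<in> E" "v \<in> e"
      and wf: "\<phi> = {Inl w, Inr f}" "f \<in> E" "w \<in> f" and ne: "(v, e) \<noteq> (w, f)"
      by auto
    show "(path_image (\<gamma> \<epsilon>) - pos ` \<epsilon>) \<inter> path_image (\<gamma> \<phi>) = {}"
      using sub[OF ve(2,3) wf(2,3) ne] by (auto simp: ve wf \<gamma> pos_def)
  qed
qed

section \<open>Coordinates in dihedral groups\<close>

text \<open>\<open>el k s\<close> stands for \<open>a^k\<close> or \<open>a^k b\<close>. Letting
  \<open>k\<close> range over all integers, with equality modulo \<open>n\<close>, keeps the product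
  rule free of reductions and turns later arguments into divisibility statements.\<close>

locale dihedral_coordinates = group G for G (structure) +
  fixes n :: nat and el :: "int \<Rightarrow> bool \<Rightarrow> 'a"
  assumes n_ge_2: "n \<ge> 2"
    and carrier_eq: "carrier G = {el k s |k s. True}"
    and el_mult: "el k s \<otimes> el l t = el (if s then k - l else k + l) (s \<noteq> t)"
    and el_eq_iff: "el k s = el l t \<longleftrightarrow> s = t \<and> int n dvd k - l"

text \<open>The relations bring every generated element into the form \<open>el k s\<close> with
  \<open>k\<close> reduced modulo \<open>n\<close>. That these 2n forms are distinct follows by
  counting, as the group has order 2n.\<close>

lemma dihedral_group_coordinates:
  assumes "n \<ge> 2" and G: "dihedral_group n G"
  obtains el where "dihedral_coordinates G n el"
proof -
  interpret group G
    using G by (simp add: dihedral_group_def)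
  obtain a b where a[simp]: "a \<in> carrier G" and b[simp]: "b \<in> carrier G"
    and gen: "generate G {a, b} = carrier G" and an: "a [^]\<^bsub>G\<^esub> n = \<one>\<^bsub>G\<^esub>"
    and b2: "b [^]\<^bsub>G\<^esub> (2::nat) = \<one>\<^bsub>G\<^esub>"
    and bab: "b \<otimes>\<^bsub>G\<^esub> a \<otimes>\<^bsub>G\<^esub> inv\<^bsub>G\<^esub> b = inv\<^bsub>G\<^esub> a"
    and card: "card (carrier G) = 2 * n"
    using G by (auto simp: dihedral_group_def Coset.order_def)
  have bb: "b \<otimes>\<^bsub>G\<^esub> b = \<one>\<^bsub>G\<^esub>"
    using b2 by (simp add: numeral_2_eq_2)
  have ba: "b \<otimes>\<^bsub>G\<^esub> a = inv\<^bsub>G\<^esub> a \<otimes>\<^bsub>G\<^esub> b"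
    using bab[symmetric] by (simp add: inv_solve_right)
  have bia: "b \<otimes>\<^bsub>G\<^esub> inv\<^bsub>G\<^esub> a = a \<otimes>\<^bsub>G\<^esub> b"
  proof -
    have "a \<otimes>\<^bsub>G\<^esub> b \<otimes>\<^bsub>G\<^esub> a = (a \<otimes>\<^bsub>G\<^esub> inv\<^bsub>G\<^esub> a) \<otimes>\<^bsub>G\<^esub> b"
      by (simp only: m_assoc ba a b inv_closed m_closed)
    then show ?thesis
      by (simp add: inv_solve_right')
  qed
  have flip: "b \<otimes>\<^bsub>G\<^esub> a [^]\<^bsub>G\<^esub> k = a [^]\<^bsub>G\<^esub> (- k) \<otimes>\<^bsub>G\<^esub> b" for k :: int
  proof (induction k rule: int_induct[where k = 0])
    case base
    then show ?case by simp
  next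
    case (step1 k)
    have "b \<otimes>\<^bsub>G\<^esub> a [^]\<^bsub>G\<^esub> (k + 1) = (b \<otimes>\<^bsub>G\<^esub> a [^]\<^bsub>G\<^esub> k) \<otimes>\<^bsub>G\<^esub> a"
      by (simp add: int_pow_mult m_assoc)
    also have "\<dots> = a [^]\<^bsub>G\<^esub> (- k) \<otimes>\<^bsub>G\<^esub> (b \<otimes>\<^bsub>G\<^esub> a)"
      by (simp add: step1 m_assoc)
    also have "\<dots> = a [^]\<^bsub>G\<^esub> (- k + - 1) \<otimes>\<^bsub>G\<^esub> b"
      unfolding ba int_pow_mult[OF a] by (simp add: m_assoc int_pow_neg)
    finally show ?case by simp
  next
    case (step2 k)
    have "b \<otimes>\<^bsub>G\<^esub> a [^]\<^bsub>G\<^esub> (k + - 1) = (b \<otimes>\<^bsub>G\<^esub> a [^]\<^bsub>G\<^esub> k) \<otimes>\<^bsub>G\<^esub> inv\<^bsub>G\<^esub> a"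
      unfolding int_pow_mult[OF a] by (simp add: m_assoc int_pow_neg)
    also have "\<dots> = a [^]\<^bsub>G\<^esub> (- k) \<otimes>\<^bsub>G\<^esub> (b \<otimes>\<^bsub>G\<^esub> inv\<^bsub>G\<^esub> a)"
      by (simp add: step2 m_assoc)
    also have "\<dots> = a [^]\<^bsub>G\<^esub> (- k + 1) \<otimes>\<^bsub>G\<^esub> b"
      unfolding bia int_pow_mult[OF a] by (simp add: m_assoc)
    finally show ?case by simp
  qed
  define el where "el k s = a [^]\<^bsub>G\<^esub> k \<otimes>\<^bsub>G\<^esub> (if s then b else \<one>\<^bsub>G\<^esub>)" for k :: int and s
  have el_closed: "el k s \<in> carrier G" for k s
    by (simp add: el_def)
  have mult: "el k s \<otimes>\<^bsub>G\<^esub> el l t = el (if s then k - l else k + l) (s \<noteq> t)" for k s l t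
  proof (cases s)
    case True
    have "el k s \<otimes>\<^bsub>G\<^esub> el l t = a [^]\<^bsub>G\<^esub> k \<otimes>\<^bsub>G\<^esub> (b \<otimes>\<^bsub>G\<^esub> a [^]\<^bsub>G\<^esub> l) \<otimes>\<^bsub>G\<^esub> (if t then b else \<one>\<^bsub>G\<^esub>)"
      using True by (simp add: el_def m_assoc)
    also have "\<dots> = a [^]\<^bsub>G\<^esub> k \<otimes>\<^bsub>G\<^esub> a [^]\<^bsub>G\<^esub> (- l) \<otimes>\<^bsub>G\<^esub> (b \<otimes>\<^bsub>G\<^esub> (if t then b else \<one>\<^bsub>G\<^esub>))"
      by (simp add: flip m_assoc)
    also have "\<dots> = el (k + - l) (\<not> t)"
      unfolding el_def int_pow_mult[OF a] by (simp add: bb)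
    finally show ?thesis
      using True by simp
  qed (simp add: el_def int_pow_mult m_assoc)
  have "generate G {a, b} \<subseteq> {el k s |k s. True}"
  proof
    fix g
    assume "g \<in> generate G {a, b}"
    then show "g \<in> {el k s |k s. True}"
    proof induction
      case one
      have "\<one>\<^bsub>G\<^esub> = el 0 False"
        by (simp add: el_def)
      then show ?case by blast
    next
      case (incl h)
      have "a = el 1 False" "b = el 0 True"
        by (simp_all add: el_def)
      then show ?case
        using incl by blast
    next
      case (inv h)
      have "inv\<^bsub>G\<^esub> a = el (- 1) False" "inv\<^bsub>G\<^esub> b = el 0 True"
        using bb by (simp_all add: el_def int_pow_neg inv_equality)
      then show ?case
        using inv by blast
    next
      case (eng h1 h2)
      then show ?case
        using mult by blast
    qed
  qed
  then have carrier: "carrier G = {el k s |k s. True}"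
    using gen el_closed by blast
  have a_mod: "a [^]\<^bsub>G\<^esub> k = a [^]\<^bsub>G\<^esub> (k mod int n)" for k :: int
  proof -
    have "a [^]\<^bsub>G\<^esub> (int n * (k div int n) + k mod int n) = a [^]\<^bsub>G\<^esub> (k mod int n)"
      unfolding int_pow_mult[OF a] int_pow_pow[OF a, symmetric] using an by (simp add: int_pow_int)
    then show ?thesis by simp
  qed
  then have el_mod: "el k s = el (k mod int n) s" for k s
    unfolding el_def by simp
  let ?D = "{0..<int n} \<times> (UNIV :: bool set)"
  have "case_prod el ` ?D = carrier G"
  proof
    show "carrier G \<subseteq> case_prod el ` ?D"
    proof
      fix g
      assume "g \<in> carrier G"
      then obtain k s where "g = el k s"
        using carrier by auto
      then have "g = case_prod el (k mod int n, s)"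
        using el_mod by simp
      then show "g \<in> case_prod el ` ?D"
        using \<open>n \<ge> 2\<close> by (intro image_eqI[of _ _ "(k mod int n, s)"]) auto
    qed
  qed (auto simp: el_closed)
  then have "card (case_prod el ` ?D) = card ?D"
    using card by (simp add: card_cartesian_product)
  then have inj: "inj_on (case_prod el) ?D"
    by (intro eq_card_imp_inj_on) auto
  have eq: "el k s = el l t \<longleftrightarrow> s = t \<and> int n dvd k - l" for k s l t
  proof -
    have "el k s = el l t \<longleftrightarrow> el (k mod int n) s = el (l mod int n) t"
      using el_mod[of k] el_mod[of l] by simp
    also have "\<dots> \<longleftrightarrow> k mod int n = l mod int n \<and> s = t"
      using inj_on_eq_iff[OF inj, of "(k mod int n, s)" "(l mod int n, t)"] \<open>n \<ge> 2\<close> by simp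
    finally show ?thesis
      by (auto simp: mod_eq_dvd_iff)
  qed
  show thesis
    by (rule that[of el]) (intro dihedral_coordinates.intro dihedral_coordinates_axioms.intro
        is_group \<open>n \<ge> 2\<close> carrier mult eq)
qed

context dihedral_coordinates
begin

lemma el_closed [simp]: "el k s \<in> carrier G"
  unfolding carrier_eq by blast

lemma carrierE:
  assumes "g \<in> carrier G" obtains k s where "g = el k s"
  using assms unfolding carrier_eq by blast

lemma el_one: "\<one> = el 0 False"
  using el_mult[of 0 False 0 False] r_cancel_one'[of "el 0 False" "el 0 False"] by simp

lemma el_inv: "inv (el k s) = el (if s then k else - k) s"
  by (rule inv_equality) (auto simp: el_mult el_one)

lemma finite_carrier: "finite (carrier G)"
proof -
  have "carrier G \<subseteq> case_prod el ` ({0..<int n} \<times> UNIV)"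
  proof
    fix g
    assume "g \<in> carrier G"
    then obtain k s where "g = el k s"
      by (rule carrierE)
    then have "g = case_prod el (k mod int n, s)"
      by (simp add: el_eq_iff)
    then show "g \<in> case_prod el ` ({0..<int n} \<times> UNIV)"
      using n_ge_2 by (intro image_eqI[of _ _ "(k mod int n, s)"]) auto
  qed
  then show ?thesis
    by (rule finite_subset) auto
qed

lemma set_mult_eq_carrier_iff:
  assumes "subgroup H G" "subgroup K G"
  shows "H <#> K = carrier G \<longleftrightarrow> (\<forall>k s. \<exists>x\<in>H. \<exists>y\<in>K. el k s = x \<otimes> y)"
proof -
  have "H <#> K = carrier G \<longleftrightarrow> carrier G \<subseteq> H <#> K"
    using setmult_subset_G[OF assms[THEN subgroup.subset]] by blast
  also have "\<dots> \<longleftrightarrow> (\<forall>k s. el k s \<in> H <#> K)"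
    by (auto simp: carrier_eq)
  finally show ?thesis
    by (simp add: set_mult_def)
qed

lemma set_mult_carrierD:
  assumes "subgroup H G" "subgroup K G" "H <#> K = carrier G"
  obtains i s j t where "el i s \<in> H" "el j t \<in> K" "u \<longleftrightarrow> s \<noteq> t" "int n dvd k - (if s then i - j else i + j)"
proof -
  obtain x y where xy: "x \<in> H" "y \<in> K" "el k u = x \<otimes> y"
    using assms(3) unfolding set_mult_eq_carrier_iff[OF assms(1,2)] by meson
  obtain i s where x: "x = el i s"
    using carrierE[OF subgroup.mem_carrier[OF assms(1) xy(1)]] .
  obtain j t where y: "y = el j t"
    using carrierE[OF subgroup.mem_carrier[OF assms(2) xy(2)]] .
  have "el k u = el (if s then i - j else i + j) (s \<noteq> t)"
    using xy x y by (simp add: el_mult)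
  then have "u \<longleftrightarrow> s \<noteq> t" "int n dvd k - (if s then i - j else i + j)"
    unfolding el_eq_iff by blast+
  then show thesis
    using xy(1,2) unfolding x y by (rule that[rotated 2])
qed

text \<open>Inverting a factorisation of \<open>inv g\<close> gives one of \<open>g\<close> with the
  factors in the opposite order.\<close>

lemma set_mult_carrier_commute:
  assumes H: "subgroup H G" and K: "subgroup K G" and HK: "H <#> K = carrier G"
  shows "K <#> H = carrier G"
  unfolding set_mult_eq_carrier_iff[OF K H]
proof (intro allI)
  fix k s
  obtain x y where xy: "x \<in> H" "y \<in> K" "inv (el k s) = x \<otimes> y"
    using HK unfolding set_mult_eq_carrier_iff[OF H K] el_inv by meson
  have "x \<in> carrier G" "y \<in> carrier G"
    using subgroup.mem_carrier[OF H xy(1)] subgroup.mem_carrier[OF K xy(2)] by blast+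
  then have "inv (inv (el k s)) = inv y \<otimes> inv x"
    unfolding xy(3) by (rule inv_mult_group)
  then have "el k s = inv y \<otimes> inv x"
    by simp
  then show "\<exists>x\<in>K. \<exists>y\<in>H. el k s = x \<otimes> y"
    using subgroup.m_inv_closed[OF H xy(1)] subgroup.m_inv_closed[OF K xy(2)] by blast
qed

section \<open>The rotation subgroup and the dihedral subgroups\<close>

definition rots :: "'a set" where
  "rots = {el k False |k. True}"

text \<open>For \<open>d\<close> dividing \<open>n\<close> this is the subgroup generated by
  \<open>a^d\<close> and \<open>a^i b\<close>. The description by congruences makes membership and
  products a matter of arithmetic modulo \<open>d\<close>.\<close>

definition dih :: "int \<Rightarrow> int \<Rightarrow> 'a set" where
  "dih d i = {el k s |k s. d dvd k - (if s then i else 0)}"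

lemma el_in_rots [simp]: "el k s \<in> rots \<longleftrightarrow> \<not> s"
  by (auto simp: rots_def el_eq_iff intro!: exI[of _ k])

lemma el_in_dih:
  assumes "d dvd int n"
  shows "el k s \<in> dih d i \<longleftrightarrow> d dvd k - (if s then i else 0)"
proof
  assume "el k s \<in> dih d i"
  then obtain l where "d dvd l - (if s then i else 0)" "int n dvd k - l"
    by (auto simp: dih_def el_eq_iff)
  then show "d dvd k - (if s then i else 0)"
    using assms dvd_add[of d "k - l" "l - (if s then i else 0)"] by (auto dest: dvd_trans)
qed (unfold dih_def, blast)

lemma subgroup_rots: "subgroup rots G"
proof (rule subgroupI)
  show "rots \<noteq> {}"
    using el_in_rots by blast
qed (auto simp: rots_def el_mult el_inv)

lemma subgroup_dih:
  assumes d: "d dvd int n"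
  shows "subgroup (dih d i) G"
proof (rule subgroupI)
  show "dih d i \<subseteq> carrier G"
    by (auto simp: dih_def)
  show "dih d i \<noteq> {}"
    using el_in_dih[OF d, of 0 False] by auto
next
  fix g
  assume "g \<in> dih d i"
  then obtain k s where "g = el k s" "d dvd k - (if s then i else 0)"
    by (auto simp: dih_def)
  then show "inv g \<in> dih d i"
    by (auto simp: el_inv el_in_dih[OF d])
next
  fix g h
  assume "g \<in> dih d i" "h \<in> dih d i"
  then obtain k s l t where g: "g = el k s" "d dvd k - (if s then i else 0)"
    and h: "h = el l t" "d dvd l - (if t then i else 0)"
    by (auto simp: dih_def)
  have "d dvd (k - (if s then i else 0)) + (l - (if t then i else 0))"
    "d dvd (k - (if s then i else 0)) - (l - (if t then i else 0))"
    using g h by (auto intro: dvd_add dvd_diff)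
  then show "g \<otimes> h \<in> dih d i"
    using g h by (auto simp: el_mult el_in_dih[OF d] algebra_simps split: if_splits)
qed

lemma rots_nontrivial_proper: "rots \<in> nontrivial_proper_subgroups G"
proof -
  have "el 1 False \<noteq> \<one>"
    using n_ge_2 by (simp add: el_one el_eq_iff)
  then have "rots \<noteq> {\<one>}"
    using el_in_rots by blast
  moreover have "rots \<noteq> carrier G"
    using el_in_rots[of 0 True] el_closed by blast
  ultimately show ?thesis
    using subgroup_rots by (simp add: nontrivial_proper_subgroups_def)
qed

lemma dih_nontrivial_proper:
  assumes d: "d dvd int n" "d \<ge> 2"
  shows "dih d i \<in> nontrivial_proper_subgroups G"
proof -
  have "el i True \<in> dih d i" "el i True \<noteq> \<one>" "el 1 False \<notin> dih d i"
    using d by (auto simp: el_in_dih el_one el_eq_iff)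
  then show ?thesis
    using subgroup_dih[OF d(1)] el_closed by (auto simp: nontrivial_proper_subgroups_def)
qed

lemma rots_dih_comaximal:
  assumes d: "d dvd int n"
  shows "rots <#> dih d i = carrier G"
  unfolding set_mult_eq_carrier_iff[OF subgroup_rots subgroup_dih[OF d]]
proof (intro allI)
  fix k s
  let ?j = "if s then i else 0"
  have "el k s = el (k - ?j) False \<otimes> el ?j s"
    by (simp add: el_mult)
  moreover have "el ?j s \<in> dih d i"
    by (simp add: el_in_dih[OF d])
  ultimately show "\<exists>x\<in>rots. \<exists>y\<in>dih d i. el k s = x \<otimes> y"
    using el_in_rots by blast
qed

text \<open>Bezout's identity splits the exponent into a multiple of \<open>d\<close>, used as a
  rotation in \<open>dih d i\<close>, and an exponent admissible in \<open>dih e j\<close>.\<close>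

lemma dih_comaximal_coprime:
  assumes d: "d dvd int n" "e dvd int n" and cop: "coprime d e"
  shows "dih d i <#> dih e j = carrier G"
  unfolding set_mult_eq_carrier_iff[OF subgroup_dih[OF d(1)] subgroup_dih[OF d(2)]]
proof (intro allI)
  fix k s
  let ?j = "if s then j else 0"
  obtain u v where "u * d + v * e = 1"
    using cop bezout_int[of d e] by auto
  then have "(k - ?j) * (u * d + v * e) = k - ?j"
    by simp
  then have "k = (k - ?j) * u * d + ((k - ?j) * v * e + ?j)"
    by (simp add: algebra_simps)
  then have "el k s = el ((k - ?j) * u * d) False \<otimes> el ((k - ?j) * v * e + ?j) s"
    by (simp add: el_mult)
  moreover have "el ((k - ?j) * u * d) False \<in> dih d i" "el ((k - ?j) * v * e + ?j) s \<in> dih e j"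
    using d by (simp_all add: el_in_dih)
  ultimately show "\<exists>x\<in>dih d i. \<exists>y\<in>dih e j. el k s = x \<otimes> y"
    by blast
qed

text \<open>Elements with even exponent already lie in \<open>dih 2 0\<close>. For odd
  \<open>k\<close>, \<open>a^k b\<close> is \<open>a^(k-1)\<close> times \<open>ab\<close>, and
  \<open>a^k\<close> is the product of the reflections \<open>a^(k+1) b\<close> and
  \<open>ab\<close>.\<close>

lemma dih_2_comaximal:
  assumes n: "even n"
  shows "dih 2 0 <#> dih 2 1 = carrier G"
proof -
  have n': "2 dvd int n"
    using n by simp
  show ?thesis
    unfolding set_mult_eq_carrier_iff[OF subgroup_dih[OF n'] subgroup_dih[OF n']]
  proof (intro allI)
    fix k :: int and s
    have factor: "\<exists>x\<in>dih 2 0. \<exists>y\<in>dih 2 1. g = x \<otimes> y" if "even k" "g = el k s \<otimes> el l t"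
      "even (l - (if t then 1 else 0))" for g s t and k l :: int
      using that by (intro bexI[of _ "el k s"] bexI[of _ "el l t"]) (auto simp: el_in_dih[OF n'])
    consider "even k" | "odd k" "s" | "odd k" "\<not> s"
      by blast
    then show "\<exists>x\<in>dih 2 0. \<exists>y\<in>dih 2 1. el k s = x \<otimes> y"
    proof cases
      case 1
      then show ?thesis
        by (rule factor[of k _ s 0 False]) (simp_all add: el_mult)
    next
      case 2
      then show ?thesis
        by (intro factor[of "k - 1" _ False 1 True]) (simp_all add: el_mult)
    next
      case 3
      then show ?thesis
        by (intro factor[of "k + 1" _ True 1 True]) (simp_all add: el_mult)
    qed
  qed
qed

text \<open>A rotation in the product comes from two rotations or two reflections, so its exponent
  is 0 or \<open>i - j\<close> modulo \<open>d\<close>. Two residue classes are too few for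
  \<open>d \<ge> 3\<close>: both 1 and 2 would have to be \<open>i - j\<close>.\<close>

lemma dih_not_comaximal:
  assumes d: "d dvd int n" "d \<ge> 3"
  shows "dih d i <#> dih d j \<noteq> carrier G"
proof
  assume *: "dih d i <#> dih d j = carrier G"
  have res: "d dvd k \<or> d dvd k - (i - j)" for k
  proof -
    obtain x s y t where xy: "el x s \<in> dih d i" "el y t \<in> dih d j" "s = t"
      "int n dvd k - (if s then x - y else x + y)"
      by (rule set_mult_carrierD[OF subgroup_dih[OF d(1)] subgroup_dih[OF d(1)] *, of False k]) blast
    have "d dvd k - (if s then x - y else x + y)"
      using d(1) xy(4) by (rule dvd_trans)
    moreover have "d dvd x - (if s then i else 0)" "d dvd y - (if s then j else 0)"
      using xy by (simp_all add: el_in_dih[OF d(1)])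
    ultimately show ?thesis
      using dvd_diff[OF dvd_add[of d "k - (x - y)" "x - i"], of "y - j"]
        dvd_add[OF dvd_add[of d "k - (x + y)" x], of y]
      by (cases s) (simp_all add: algebra_simps)
  qed
  have "\<not> d dvd 1" "\<not> d dvd 2"
    using d(2) zdvd_imp_le[of d 1] zdvd_imp_le[of d 2] by auto
  then have "d dvd 1 - (i - j)" "d dvd 2 - (i - j)"
    using res by blast+
  then have "d dvd (2 - (i - j)) - (1 - (i - j))"
    by (rule dvd_diff[rotated])
  then show False
    using \<open>\<not> d dvd 1\<close> by simp
qed

lemma rot_multiple_mem:
  assumes H: "subgroup H G" and k: "el k False \<in> H"
  shows "el (k * c) False \<in> H"
proof (induction c rule: int_induct[where k = 0])
  case base
  then show ?case
    using subgroup.one_closed[OF H] by (simp add: el_one)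
next
  case (step1 c)
  have "el (k * (c + 1)) False = el (k * c) False \<otimes> el k False"
    by (simp add: el_mult algebra_simps)
  then show ?case
    using subgroup.m_closed[OF H step1(2) k] by simp
next
  case (step2 c)
  have "el (k * (c - 1)) False = el (k * c) False \<otimes> inv (el k False)"
    by (simp add: el_mult el_inv algebra_simps)
  then show ?case
    using subgroup.m_closed[OF H step2(2) subgroup.m_inv_closed[OF H k]] by simp
qed

lemma rot_gcd_mem:
  assumes H: "subgroup H G" and k: "el k False \<in> H" and l: "gcd k (int n) dvd l"
  shows "el l False \<in> H"
proof -
  obtain u v where "u * k + v * int n = gcd k (int n)"
    using bezout_int by blast
  moreover obtain c where "l = gcd k (int n) * c"
    using l by blast
  ultimately have "l - k * (u * c) = int n * (v * c)"
    by (simp add: algebra_simps flip: distrib_left)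
  then have "el l False = el (k * (u * c)) False"
    by (simp add: el_eq_iff)
  then show ?thesis
    using rot_multiple_mem[OF H k] by simp
qed

end

section \<open>Comaximal hyperedges\<close>

lemma finite_comaximal_vertices:
  assumes "finite (carrier G)"
  shows "finite (comaximal_vertices G)"
proof -
  have "comaximal_vertices G \<subseteq> Pow (carrier G)"
    by (auto simp: comaximal_vertices_def nontrivial_proper_subgroups_def dest: subgroup.subset)
  then show ?thesis
    using assms finite_subset by blast
qed

text \<open>Hyperedges are the maximal cliques of the comaximality relation, so finiteness supplies
  hyperedges with prescribed members.\<close>

lemma comaximal_hyperedge_extend:
  fixes G :: "('a, 'b) monoid_scheme"
  assumes fin: "finite (carrier G)" and C: "C \<subseteq> comaximal_vertices G"
    and clique: "pairwise (\<lambda>H K. H <#>\<^bsub>G\<^esub> K = carrier G) C"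
  obtains e where "e \<in> comaximal_hyperedges G" "C \<subseteq> e"
proof -
  let ?A = "{E. C \<subseteq> E \<and> E \<subseteq> comaximal_vertices G \<and> pairwise (\<lambda>H K. H <#>\<^bsub>G\<^esub> K = carrier G) E}"
  have "finite (comaximal_vertices G)"
    using fin by (rule finite_comaximal_vertices)
  then have fin_A: "finite ?A"
    by (rule finite_subset[rotated, OF finite_Pow_iff[THEN iffD2]]) auto
  have C_A: "C \<in> ?A"
    using C clique by simp
  obtain e where e: "e \<in> ?A" and max: "\<forall>E\<in>?A. e \<subseteq> E \<longrightarrow> e = E"
    using finite_has_maximal2[OF fin_A C_A] by (elim bexE conjE)
  have "e \<in> comaximal_hyperedges G"
    unfolding comaximal_hyperedges_def
  proof (intro CollectI conjI notI)
    assume "\<exists>E'\<subseteq>comaximal_vertices G. e \<subset> E' \<and> pairwise (\<lambda>H K. H <#>\<^bsub>G\<^esub> K = carrier G) E'"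
    then obtain E' where E': "E' \<subseteq> comaximal_vertices G" "e \<subset> E'"
      "pairwise (\<lambda>H K. H <#>\<^bsub>G\<^esub> K = carrier G) E'"
      by meson
    then have "E' \<in> ?A"
      using e by auto
    then show False
      using max E'(2) by blast
  qed (use e in simp_all)
  then show thesis
    using e that by simp
qed

text \<open>If the union of two maximal cliques is a clique, both equal it. A pair with a member in
  \<open>C\<close> lies inside \<open>e\<close> or inside \<open>f\<close>, so only pairs outside
  \<open>C\<close> remain to be checked.\<close>

lemma comaximal_hyperedges_eqI:
  assumes e: "e \<in> comaximal_hyperedges G" and f: "f \<in> comaximal_hyperedges G"
    and C: "C \<subseteq> e \<inter> f"
    and clique: "\<And>K L. K \<in> e \<union> f - C \<Longrightarrow> L \<in> e \<union> f - C \<Longrightarrow> K \<noteq> L \<Longrightarrow> K <#>\<^bsub>G\<^esub> L = carrier G"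
  shows "e = f"
proof -
  have e': "e \<subseteq> comaximal_vertices G" "pairwise (\<lambda>H K. H <#>\<^bsub>G\<^esub> K = carrier G) e"
    "\<And>E. E \<subseteq> comaximal_vertices G \<Longrightarrow> pairwise (\<lambda>H K. H <#>\<^bsub>G\<^esub> K = carrier G) E \<Longrightarrow> \<not> e \<subset> E"
    and f': "f \<subseteq> comaximal_vertices G" "pairwise (\<lambda>H K. H <#>\<^bsub>G\<^esub> K = carrier G) f"
    "\<And>E. E \<subseteq> comaximal_vertices G \<Longrightarrow> pairwise (\<lambda>H K. H <#>\<^bsub>G\<^esub> K = carrier G) E \<Longrightarrow> \<not> f \<subset> E"
    using e f unfolding comaximal_hyperedges_def by blast+
  have "pairwise (\<lambda>H K. H <#>\<^bsub>G\<^esub> K = carrier G) (e \<union> f)"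
  proof (rule pairwiseI)
    fix K L
    assume KL: "K \<in> e \<union> f" "L \<in> e \<union> f" "K \<noteq> L"
    then consider "K \<in> e" "L \<in> e" | "K \<in> f" "L \<in> f" | "K \<in> e \<union> f - C" "L \<in> e \<union> f - C"
      using C by blast
    then show "K <#>\<^bsub>G\<^esub> L = carrier G"
      using KL(3) e'(2) f'(2) clique by cases (auto dest: pairwiseD)
  qed
  moreover have "e \<union> f \<subseteq> comaximal_vertices G"
    using e' f' by blast
  ultimately have "\<not> e \<subset> e \<union> f" "\<not> f \<subset> e \<union> f"
    using e'(3) f'(3) by blast+
  then show ?thesis
    by blast
qed

lemma two_prime_divisors:
  assumes "n \<ge> 2" and not_power: "\<not> (\<exists>(p::nat) \<alpha>. prime p \<and> \<alpha> > 0 \<and> n = p ^ \<alpha>)"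
  obtains p q :: nat where "prime p" "prime q" "p \<noteq> q" "p dvd n" "q dvd n"
proof -
  obtain p where p: "prime p" "p dvd n"
    using \<open>n \<ge> 2\<close> prime_factor_nat[of n] by auto
  have "\<exists>q. prime q \<and> q dvd n \<and> q \<noteq> p"
  proof (rule ccontr)
    assume "\<nexists>q. prime q \<and> q dvd n \<and> q \<noteq> p"
    then have "{q. prime q \<and> q dvd n} = {p}"
      using p by blast
    then have "prime_factors n = {p}"
      using \<open>n \<ge> 2\<close> by (simp add: prime_factors_dvd)
    then have "p ^ multiplicity p n = n"
      using prod_prime_factors[of n] \<open>n \<ge> 2\<close> by simp
    moreover have "multiplicity p n > 0"
      using p \<open>n \<ge> 2\<close> by (intro prime_multiplicity_gt_zero_iff[THEN iffD2]) auto
    ultimately show False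
      using not_power p(1) by metis
  qed
  then show thesis
    using that p by metis
qed

section \<open>Nonplanarity when two primes divide n\<close>

context dihedral_coordinates
begin

lemma comaximal_vertexI:
  assumes "H \<in> nontrivial_proper_subgroups G" "K \<in> nontrivial_proper_subgroups G"
    and "H <#> K = carrier G"
  shows "H \<in> comaximal_vertices G" "K \<in> comaximal_vertices G"
  using assms set_mult_carrier_commute[of H K]
  by (auto simp: comaximal_vertices_def nontrivial_proper_subgroups_def)

lemma dih_rots_comaximal:
  assumes "d dvd int n"
  shows "dih d i <#> rots = carrier G"
  using set_mult_carrier_commute[OF subgroup_rots subgroup_dih rots_dih_comaximal] assms by blast

lemma dih_comaximal_vertex:
  assumes "d dvd int n" "d \<ge> 2"
  shows "dih d i \<in> comaximal_vertices G"
  using comaximal_vertexI(1)[OF dih_nontrivial_proper rots_nontrivial_proper dih_rots_comaximal] assms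
  by blast

lemma dih_inj:
  assumes "d dvd int n" "0 \<le> i" "i < d" "0 \<le> j" "j < d" "dih d i = dih d j"
  shows "i = j"
proof -
  have "el i True \<in> dih d j"
    using assms el_in_dih[of d i True i] by simp
  then have "d dvd i - j"
    using assms by (simp add: el_in_dih)
  then show ?thesis
    using assms by (metis mod_eq_dvd_iff mod_pos_pos_trivial)
qed

lemma comaximal_imp_neq:
  assumes "H \<in> nontrivial_proper_subgroups G" "H <#> K = carrier G"
  shows "H \<noteq> K"
proof
  assume "H = K"
  then have "H <#> H = carrier G" "subgroup H G" "H \<noteq> carrier G"
    using assms by (auto simp: nontrivial_proper_subgroups_def)
  then show False
    using subgroup_mult_id by blast
qed

lemma not_planar_if_two_odd_primes:
  assumes p: "prime p" "p dvd n" "p \<ge> 3" and q: "prime q" "q dvd n" "q \<ge> 3" and ne: "p \<noteq> q"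
  shows "\<not> planar_hypergraph (comaximal_hypergraph G)"
proof -
  let ?P = "int p" and ?Q = "int q"
  have d: "?P dvd int n" "?Q dvd int n" and ge: "?P \<ge> 3" "?Q \<ge> 3" "?P \<ge> 2" "?Q \<ge> 2"
    using p q by auto
  have cop: "coprime ?P ?Q" "coprime ?Q ?P"
    using primes_coprime[OF p(1) q(1) ne] by (simp_all add: coprime_commute)
  have comax: "dih ?P i <#> dih ?Q j = carrier G" "dih ?Q j <#> dih ?P i = carrier G" for i j
    using dih_comaximal_coprime[OF d cop(1)] dih_comaximal_coprime[OF d(2,1) cop(2)] by auto
  have neq: "dih ?P i \<noteq> dih ?Q j" for i j
    using comaximal_imp_neq[OF dih_nontrivial_proper[OF d(1) ge(3)] comax(1)] by blast
  have "\<exists>e. e \<in> comaximal_hyperedges G \<and> {dih ?P (int i), dih ?Q (int j)} \<subseteq> e" for i j :: nat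
  proof (rule comaximal_hyperedge_extend[OF finite_carrier, of "{dih ?P (int i), dih ?Q (int j)}"])
    show "{dih ?P (int i), dih ?Q (int j)} \<subseteq> comaximal_vertices G"
      using dih_comaximal_vertex[OF d(1) ge(3)] dih_comaximal_vertex[OF d(2) ge(4)] by blast
    show "pairwise (\<lambda>H K. H <#> K = carrier G) {dih ?P (int i), dih ?Q (int j)}"
      using comax by (auto simp: pairwise_insert)
  qed blast
  then obtain e where e: "e i j \<in> comaximal_hyperedges G" "{dih ?P (int i), dih ?Q (int j)} \<subseteq> e i j"
    for i j :: nat
    by metis
  have e_vert: "e i j \<subseteq> comaximal_vertices G" "pairwise (\<lambda>H K. H <#> K = carrier G) (e i j)" for i j
    using e(1)[of i j] by (auto simp: comaximal_hyperedges_def)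
  have eq: "i = k" if "i < 3" "k < 3" "dih d (int i) = dih d (int k)" "d dvd int n" "d \<ge> 3" for i k d
    using dih_inj[OF that(4) _ _ _ _ that(3)] that by simp
  \<comment> \<open>A hyperedge equal to both \<open>e i j\<close> and \<open>e k l\<close> contains
    the vertices for \<open>p\<close> with indices \<open>i\<close> and \<open>k\<close>. As
    \<open>p \<ge> 3\<close>, these are not comaximal and must coincide; likewise for
    \<open>q\<close>.\<close>
  have e_inj: "i = k \<and> j = l" if "i < 3" "j < 3" "k < 3" "l < 3" "e i j = e k l" for i j k l
  proof -
    have mem: "dih ?P (int i) \<in> e i j" "dih ?P (int k) \<in> e i j"
      "dih ?Q (int j) \<in> e i j" "dih ?Q (int l) \<in> e i j"
      using e(2)[of i j] e(2)[of k l] that by simp_all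
    have "dih ?P (int i) = dih ?P (int k)"
      using pairwiseD[OF e_vert(2) mem(1,2)] dih_not_comaximal[OF d(1) ge(1)] by blast
    moreover have "dih ?Q (int j) = dih ?Q (int l)"
      using pairwiseD[OF e_vert(2) mem(3,4)] dih_not_comaximal[OF d(2) ge(2)] by blast
    ultimately show ?thesis
      using eq[OF that(1,3) _ d(1) ge(1)] eq[OF that(2,4) _ d(2) ge(2)] by blast
  qed
  let ?I = "incidence_graph (comaximal_hypergraph G)"
  have "\<not> planar_graph (fst ?I, snd ?I)"
  proof (rule subdivided_K33_not_planar[of _ _ "\<lambda>i. Inl (dih ?P (int i))" "\<lambda>j. Inl (dih ?Q (int j))"
        "\<lambda>i j. Inr (e i j)"])
    show "\<Union>(snd ?I) \<subseteq> fst ?I"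
      by (auto simp: incidence_graph_def comaximal_hypergraph_def)
    show "{Inl (dih ?P (int i)), Inr (e i j)} \<in> snd ?I \<and> {Inr (e i j), Inl (dih ?Q (int j))} \<in> snd ?I"
      for i j
      using e[of i j] e_vert[of i j]
      by (auto simp: incidence_graph_def comaximal_hypergraph_def insert_commute)
  qed (use eq neq d ge e_inj in \<open>auto simp: inj_on_def\<close>)
  then show ?thesis
    by (simp add: planar_hypergraph_def)
qed

lemma not_planar_if_even:
  assumes p: "p dvd n" "p \<ge> 3" "odd p" and even: "even n"
  shows "\<not> planar_hypergraph (comaximal_hypergraph G)"
proof -
  let ?P = "int p"
  have d: "?P dvd int n" "2 dvd int n" and ge: "?P \<ge> 3" "?P \<ge> 2"
    using p even by auto
  have cop: "coprime 2 ?P" "coprime ?P 2"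
    using p(3) by (simp_all add: coprime_commute)
  have comax: "rots <#> dih 2 i = carrier G" "dih 2 i <#> rots = carrier G"
    "rots <#> dih ?P i = carrier G" "dih ?P i <#> rots = carrier G"
    "dih 2 i <#> dih ?P j = carrier G" "dih ?P j <#> dih 2 i = carrier G"
    "dih 2 0 <#> dih 2 1 = carrier G" "dih 2 1 <#> dih 2 0 = carrier G" for i j
    using rots_dih_comaximal dih_rots_comaximal d dih_comaximal_coprime[OF d(2,1) cop(1)]
      dih_comaximal_coprime[OF d cop(2)] dih_2_comaximal[OF even]
      set_mult_carrier_commute[OF subgroup_dih[OF d(2)] subgroup_dih[OF d(2)]] by auto
  define A where "A i = (if i = 0 then rots else dih 2 (int i - 1))" for i :: nat
  have A: "A 0 = rots" "A 1 = dih 2 0" "A 2 = dih 2 1"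
    by (auto simp: A_def)
  have lt3: "i = 0 \<or> i = 1 \<or> i = 2" if "i < 3" for i :: nat
    using that by auto
  have A_comax: "A i <#> A k = carrier G" if "i < 3" "k < 3" "i \<noteq> k" for i k
    using lt3[OF that(1)] lt3[OF that(2)] that(3) comax A by auto
  have A_vert: "A i \<in> comaximal_vertices G" for i
    using dih_comaximal_vertex[OF d(2)]
      comaximal_vertexI(2)[OF dih_nontrivial_proper[OF d(2)] rots_nontrivial_proper comax(2)]
    by (auto simp: A_def)
  have A_proper: "A i \<in> nontrivial_proper_subgroups G" for i
    using A_vert[of i] by (simp add: comaximal_vertices_def)
  have inj_A: "inj_on A {..<3}"
    unfolding inj_on_def using A_comax comaximal_imp_neq[OF A_proper] by (metis lessThan_iff)
  have "\<exists>e. e \<in> comaximal_hyperedges G \<and> insert (dih ?P (int j)) (A ` {..<3}) \<subseteq> e" for j :: nat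
  proof (rule comaximal_hyperedge_extend[OF finite_carrier, of "insert (dih ?P (int j)) (A ` {..<3})"])
    show "insert (dih ?P (int j)) (A ` {..<3}) \<subseteq> comaximal_vertices G"
      using A_vert dih_comaximal_vertex[OF d(1) ge(2)] by blast
    show "pairwise (\<lambda>H K. H <#> K = carrier G) (insert (dih ?P (int j)) (A ` {..<3}))"
      unfolding pairwise_insert
    proof (intro conjI ballI impI)
      show "pairwise (\<lambda>H K. H <#> K = carrier G) (A ` {..<3})"
        using A_comax by (auto simp: pairwise_def)
    qed (auto simp: A_def comax)
  qed blast
  then obtain e where e: "e j \<in> comaximal_hyperedges G" "insert (dih ?P (int j)) (A ` {..<3}) \<subseteq> e j"
    for j :: nat
    by metis
  have e_inj: "j = l" if "j < 3" "l < 3" "e j = e l" for j l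
  proof -
    have clique: "pairwise (\<lambda>H K. H <#> K = carrier G) (e j)"
      using e(1)[of j] by (simp add: comaximal_hyperedges_def)
    have mem: "dih ?P (int j) \<in> e j" "dih ?P (int l) \<in> e j"
      using e(2)[of j] e(2)[of l] that by auto
    have "dih ?P (int j) = dih ?P (int l)"
      using pairwiseD[OF clique mem] dih_not_comaximal[OF d(1) ge(1)] by blast
    then show ?thesis
      using dih_inj[OF d(1), of "int j" "int l"] that ge by simp
  qed
  let ?I = "incidence_graph (comaximal_hypergraph G)"
  have "\<not> planar_graph (fst ?I, snd ?I)"
  proof (rule K33_not_planar[of _ _ "\<lambda>i. Inl (A i)" "\<lambda>j. Inr (e j)"])
    show "\<Union>(snd ?I) \<subseteq> fst ?I"
      by (auto simp: incidence_graph_def comaximal_hypergraph_def)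
    show "{Inl (A i), Inr (e j)} \<in> snd ?I" if "i < 3" for i j
      using e[of j] A_vert[of i] that by (auto simp: incidence_graph_def comaximal_hypergraph_def)
  qed (use inj_A e_inj in \<open>auto simp: inj_on_def\<close>)
  then show ?thesis
    by (simp add: planar_hypergraph_def)
qed

lemma not_planar_if_not_prime_power:
  assumes "\<not> (\<exists>(p::nat) \<alpha>. prime p \<and> \<alpha> > 0 \<and> n = p ^ \<alpha>)"
  shows "\<not> planar_hypergraph (comaximal_hypergraph G)"
proof -
  obtain p q :: nat where pq: "prime p" "prime q" "p \<noteq> q" "p dvd n" "q dvd n"
    by (rule two_prime_divisors[OF n_ge_2 assms])
  have *: "r = 2 \<or> r \<ge> 3 \<and> odd r" if "prime r" for r :: nat
    using that prime_ge_2_nat[OF that] prime_odd_nat[of r] by (cases "r = 2") auto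
  consider "p = 2" "q \<ge> 3" "odd q" | "q = 2" "p \<ge> 3" "odd p" | "p \<ge> 3" "q \<ge> 3"
    using *[OF pq(1)] *[OF pq(2)] pq(3) by auto
  then show ?thesis
  proof cases
    case 1
    then show ?thesis
      using not_planar_if_even pq by blast
  next
    case 2
    then show ?thesis
      using not_planar_if_even pq by blast
  next
    case 3
    then show ?thesis
      using not_planar_if_two_odd_primes pq by blast
  qed
qed

section \<open>Planarity for prime powers\<close>

lemma subgroup_el_mem:
  assumes "subgroup H G" "el k s \<in> H" "el l t \<in> H"
  shows "el (if s then k - l else k + l) (s \<noteq> t) \<in> H"
  using subgroup.m_closed[OF assms] by (simp add: el_mult)

context
  fixes p \<alpha> :: nat
  assumes prime_p: "prime p" and n_eq: "n = p ^ \<alpha>"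
begin

lemma p_dvd_n: "int p dvd int n"
proof -
  have "\<alpha> \<noteq> 0"
    using n_eq n_ge_2 by (cases "\<alpha> = 0") auto
  then show ?thesis
    by (simp add: n_eq dvd_power)
qed

text \<open>An exponent not divisible by \<open>p\<close> is coprime to \<open>n\<close>, so
  \<open>H\<close> would contain every rotation. With any reflection it would then be the whole
  group, and without one it would be \<open>rots\<close>.\<close>

lemma p_dvd_rotation:
  assumes H: "H \<in> nontrivial_proper_subgroups G" "H \<noteq> rots" and k: "el k False \<in> H"
  shows "int p dvd k"
proof (rule ccontr)
  assume "\<not> int p dvd k"
  then have "coprime (int p) k"
    using prime_p by (intro prime_imp_coprime) auto
  then have "gcd k (int n) = 1"
    by (simp add: n_eq coprime_iff_gcd_eq_1[symmetric] coprime_commute)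
  moreover have sub: "subgroup H G" "H \<noteq> carrier G"
    using H by (auto simp: nontrivial_proper_subgroups_def)
  ultimately have rot: "el l False \<in> H" for l
    using rot_gcd_mem[OF _ k] by simp
  have "H \<subseteq> rots"
  proof (rule ccontr)
    assume "\<not> H \<subseteq> rots"
    then obtain g where "g \<in> H" "g \<notin> rots"
      by blast
    moreover obtain j s where "g = el j s"
      using carrierE[OF subgroup.mem_carrier[OF sub(1) \<open>g \<in> H\<close>]] .
    ultimately have j: "el j True \<in> H"
      by (cases s) auto
    have "el l s \<in> H" for l s
      using subgroup_el_mem[OF sub(1) rot[of "l - j"] j] rot by (cases s) auto
    then have "carrier G \<subseteq> H"
      unfolding carrier_eq by blast
    then show False
      using sub subgroup.subset by blast
  qed
  then show False
    using H(2) rot unfolding rots_def by blast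
qed

text \<open>Factor the rotation \<open>a\<close> itself: two rotations would have exponents
  divisible by \<open>p\<close> with sum 1 modulo \<open>p\<close>, so both factors are
  reflections.\<close>

lemma comaximal_has_reflection:
  assumes H: "H \<in> nontrivial_proper_subgroups G" "H \<noteq> rots"
    and K: "K \<in> nontrivial_proper_subgroups G" "K \<noteq> rots" and HK: "H <#> K = carrier G"
  obtains i where "el i True \<in> H"
proof -
  have sub: "subgroup H G" "subgroup K G"
    using H K by (auto simp: nontrivial_proper_subgroups_def)
  obtain x s y t where xy: "el x s \<in> H" "el y t \<in> K" "False \<longleftrightarrow> s \<noteq> t"
    "int n dvd 1 - (if s then x - y else x + y)"
    by (rule set_mult_carrierD[OF sub HK, of False 1])
  have "s"
  proof (rule ccontr)
    assume "\<not> s"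
    then have "int p dvd x" "int p dvd y" "int p dvd 1 - (x + y)"
      using p_dvd_rotation[OF H, of x] p_dvd_rotation[OF K, of y] xy dvd_trans[OF p_dvd_n] by auto
    then have "int p dvd (1 - (x + y)) + x + y"
      by (intro dvd_add)
    then show False
      using prime_p by (simp add: prime_nat_iff)
  qed
  then show thesis
    using xy(1) that[of x] by simp
qed

text \<open>Two reflections in the same subgroup differ by a rotation whose exponent is divisible by
  \<open>p\<close>. Hence rotations in the product have exponent 0 or \<open>i - j\<close> modulo
  \<open>p\<close>, and since all residues occur, \<open>p = 2\<close> and \<open>i - j\<close> is
  in the class of 1.\<close>

lemma comaximal_reflections:
  assumes H: "H \<in> nontrivial_proper_subgroups G" "H \<noteq> rots"
    and K: "K \<in> nontrivial_proper_subgroups G" "K \<noteq> rots" and HK: "H <#> K = carrier G"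
    and i: "el i True \<in> H" and j: "el j True \<in> K"
  shows "p = 2 \<and> odd (i - j)"
proof -
  have sub: "subgroup H G" "subgroup K G"
    using H K by (auto simp: nontrivial_proper_subgroups_def)
  have residue: "int p dvd c \<or> int p dvd c - (i - j)" for c
  proof -
    obtain x s y t where xy: "el x s \<in> H" "el y t \<in> K" "False \<longleftrightarrow> s \<noteq> t"
      "int n dvd c - (if s then x - y else x + y)"
      by (rule set_mult_carrierD[OF sub HK, of False c])
    have c: "int p dvd c - (if s then x - y else x + y)"
      using dvd_trans[OF p_dvd_n xy(4)] .
    show ?thesis
    proof (cases s)
      case True
      then have xi: "int p dvd x - i" and yj: "int p dvd y - j"
        using p_dvd_rotation[OF H, of "x - i"] p_dvd_rotation[OF K, of "y - j"]
          subgroup_el_mem[OF sub(1) xy(1) i] subgroup_el_mem[OF sub(2) xy(2) j] xy(3) by auto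
      have "int p dvd c - (x - y)"
        using c True by simp
      then have "int p dvd (c - (x - y)) + (x - i) - (y - j)"
        using dvd_diff[OF dvd_add[OF _ xi] yj] by blast
      then show ?thesis
        by (simp add: algebra_simps)
    next
      case False
      then have "int p dvd x" "int p dvd y"
        using p_dvd_rotation[OF H, of x] p_dvd_rotation[OF K, of y] xy by auto
      then have "int p dvd (c - (x + y)) + x + y"
        using c False by (intro dvd_add) auto
      then show ?thesis
        by simp
    qed
  qed
  have not1: "\<not> int p dvd 1"
    using prime_p by (simp add: prime_nat_iff)
  then have diff1: "int p dvd 1 - (i - j)"
    using residue by blast
  have "int p dvd 2"
  proof (rule ccontr)
    assume "\<not> int p dvd 2"
    then have "int p dvd 2 - (i - j)"
      using residue by blast
    then have "int p dvd (2 - (i - j)) - (1 - (i - j))"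
      using diff1 by (rule dvd_diff)
    then show False
      using not1 by simp
  qed
  then have "int p \<le> 2"
    by (rule zdvd_imp_le) simp
  then have "p = 2"
    using prime_ge_2_nat[OF prime_p] by simp
  then show ?thesis
    using diff1 by simp
qed

text \<open>The rotations in \<open>H\<close> are exactly the even powers of \<open>a\<close>, and
  its reflections are those whose exponent has the parity of \<open>i\<close>.\<close>

lemma eq_dih_2:
  assumes H: "H \<in> nontrivial_proper_subgroups G" "H \<noteq> rots" and "p = 2"
    and two: "el 2 False \<in> H" and i: "el i True \<in> H"
  shows "H = dih 2 0 \<or> H = dih 2 1"
proof -
  have sub: "subgroup H G"
    using H by (auto simp: nontrivial_proper_subgroups_def)
  have n2: "2 dvd int n"
    using p_dvd_n \<open>p = 2\<close> by simp
  have rot: "el k False \<in> H \<longleftrightarrow> even k" for k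
  proof
    assume "even k"
    then show "el k False \<in> H"
      using rot_multiple_mem[OF sub two] by (auto elim!: evenE)
  qed (use p_dvd_rotation[OF H, of k] \<open>p = 2\<close> in simp)
  have refl: "el k True \<in> H \<longleftrightarrow> even (k - i)" for k
  proof
    assume "el k True \<in> H"
    then show "even (k - i)"
      using subgroup_el_mem[OF sub _ i, of k True] rot by simp
  next
    assume "even (k - i)"
    then show "el k True \<in> H"
      using subgroup_el_mem[OF sub _ i, of "k - i" False] rot by simp
  qed
  have "el k s \<in> H \<longleftrightarrow> el k s \<in> dih 2 (i mod 2)" for k s
    by (cases s) (simp_all add: rot refl el_in_dih[OF n2] mod_2_eq_odd)
  moreover have "H \<subseteq> carrier G" "dih 2 (i mod 2) \<subseteq> carrier G"
    using sub subgroup_dih[OF n2] subgroup.subset by blast+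
  ultimately have "H = dih 2 (i mod 2)"
    unfolding carrier_eq by blast
  moreover have "i mod 2 = 0 \<or> i mod 2 = 1"
    by presburger
  ultimately show ?thesis
    by metis
qed

text \<open>\<open>gcd x (int n)\<close> is a power of 2 not divisible by 4, hence 1 or 2, and
  \<open>H\<close> contains the rotations by its multiples.\<close>

lemma el_2_mem:
  assumes "subgroup H G" "p = 2" and x: "el x False \<in> H" "\<not> 4 dvd x"
  shows "el 2 False \<in> H"
proof -
  have "nat (gcd x (int n)) dvd 2 ^ \<alpha>"
    using \<open>p = 2\<close> by (simp add: n_eq nat_dvd_iff)
  then obtain m where m: "nat (gcd x (int n)) = 2 ^ m"
    using divides_primepow_nat[OF two_is_prime_nat] by blast
  then have gcd_eq: "gcd x (int n) = 2 ^ m"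
    by (metis gcd_ge_0_int int_nat_eq of_nat_numeral of_nat_power)
  have "m < 2"
  proof (rule ccontr)
    assume "\<not> m < 2"
    then have "(2::int) ^ 2 dvd 2 ^ m"
      by (intro le_imp_power_dvd) simp
    then have "4 dvd gcd x (int n)"
      by (simp add: gcd_eq)
    then show False
      using x(2) by (meson dvd_trans gcd_dvd1)
  qed
  then have "gcd x (int n) dvd 2"
    unfolding gcd_eq by (cases m) auto
  then show ?thesis
    by (rule rot_gcd_mem[OF assms(1) x(1)])
qed

text \<open>Factor \<open>a^2\<close>: two reflections would give an odd exponent, so both factors
  are rotations with \<open>x + y\<close> congruent to 2 modulo \<open>n\<close>. If 4 divides
  \<open>n\<close>, then \<open>x\<close> or \<open>y\<close> is not divisible by 4, and the
  subgroup of that rotation contains \<open>a^2\<close>. For \<open>n = 2\<close> the element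
  \<open>a^2\<close> is the identity.\<close>

lemma comaximal_dih_2:
  assumes H: "H \<in> nontrivial_proper_subgroups G" "H \<noteq> rots"
    and K: "K \<in> nontrivial_proper_subgroups G" "K \<noteq> rots" and HK: "H <#> K = carrier G"
  shows "H \<in> {dih 2 0, dih 2 1} \<or> K \<in> {dih 2 0, dih 2 1}"
proof -
  have sub: "subgroup H G" "subgroup K G"
    using H K by (auto simp: nontrivial_proper_subgroups_def)
  obtain i where i: "el i True \<in> H"
    using comaximal_has_reflection[OF H K HK] .
  obtain j where j: "el j True \<in> K"
    using comaximal_has_reflection[OF K H set_mult_carrier_commute[OF sub HK]] .
  have p2: "p = 2"
    using comaximal_reflections[OF H K HK i j] by simp
  obtain x s y t where xy: "el x s \<in> H" "el y t \<in> K" "False \<longleftrightarrow> s \<noteq> t"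
    "int n dvd 2 - (if s then x - y else x + y)"
    by (rule set_mult_carrierD[OF sub HK, of False 2])
  have "\<not> s"
  proof
    assume s
    then have "odd (x - y)"
      using comaximal_reflections[OF H K HK, of x y] xy by simp
    moreover have "2 dvd 2 - (x - y)"
      using dvd_trans[OF p_dvd_n xy(4)] p2 \<open>s\<close> by simp
    ultimately show False
      by simp
  qed
  then have rot: "el x False \<in> H" "el y False \<in> K" "int n dvd 2 - (x + y)"
    using xy by auto
  have "el 2 False \<in> H \<or> el 2 False \<in> K"
  proof (cases "\<alpha> \<le> 1")
    case True
    then have "n dvd 2"
      using n_eq p2 by (cases \<alpha>) auto
    then have "el 2 False = \<one>"
      by (simp add: el_one el_eq_iff) (metis int_dvd_int_iff of_nat_numeral)
    then show ?thesis
      using subgroup.one_closed[OF sub(1)] by simp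
  next
    case False
    then have "(2::int) ^ 2 dvd 2 ^ \<alpha>"
      by (intro le_imp_power_dvd) simp
    then have "4 dvd int n"
      by (simp add: n_eq p2)
    then have "4 dvd 2 - (x + y)"
      using rot(3) by (rule dvd_trans)
    then have "\<not> 4 dvd x \<or> \<not> 4 dvd y"
      by presburger
    then show ?thesis
      using el_2_mem[OF sub(1) p2 rot(1)] el_2_mem[OF sub(2) p2 rot(2)] by blast
  qed
  then show ?thesis
    using eq_dih_2[OF H p2 _ i] eq_dih_2[OF K p2 _ j] by blast
qed

lemma hyperedge_comaximal:
  assumes "e \<in> comaximal_hyperedges G" "H \<in> e" "K \<in> e" "H \<noteq> K"
  shows "H <#> K = carrier G"
  using assms by (auto simp: comaximal_hyperedges_def dest: pairwiseD)

lemma hyperedge_proper: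
  assumes "e \<in> comaximal_hyperedges G" "H \<in> e"
  shows "H \<in> nontrivial_proper_subgroups G"
  using assms by (auto simp: comaximal_hyperedges_def comaximal_vertices_def)

lemma planar_if_prime_power: "planar_hypergraph (comaximal_hypergraph G)"
proof -
  txt \<open>For odd \<open>p\<close> there is nothing in the role of \<open>dih 2 0\<close> and \<open>dih 2 1\<close>; any two sets that are
    not vertices serve as placeholders.\<close>
  define X where "X = (if p = 2 then dih 2 0 else {})"
  define Y where "Y = (if p = 2 then dih 2 1 else {\<one>})"
  have n2: "2 dvd int n" if "p = 2"
    using p_dvd_n that by simp
  have not_sub: "\<not> subgroup {} G"
    using subgroup.one_closed by blast
  have XY: "X \<noteq> Y" "X \<noteq> rots" "Y \<noteq> rots"
  proof -
    have "el 0 True \<in> dih 2 0" "el 1 True \<in> dih 2 1" "el 1 True \<notin> dih 2 0" if "p = 2"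
      using n2[OF that] by (simp_all add: el_in_dih)
    moreover have "rots \<noteq> {\<one>}" "rots \<noteq> {}"
      using rots_nontrivial_proper not_sub by (auto simp: nontrivial_proper_subgroups_def)
    ultimately show "X \<noteq> Y" "X \<noteq> rots" "Y \<noteq> rots"
      unfolding X_def Y_def by (metis el_in_rots insert_not_empty)+
  qed
  have XY_vertex: "p = 2" if "X \<in> nontrivial_proper_subgroups G \<or> Y \<in> nontrivial_proper_subgroups G"
    using that not_sub by (auto simp: X_def Y_def nontrivial_proper_subgroups_def split: if_splits)
  have special: "K <#> L = carrier G" if "p = 2" "K \<in> {rots, X, Y}" "L \<in> {rots, X, Y}" "K \<noteq> L" for K L
    using that rots_dih_comaximal[OF n2] dih_rots_comaximal[OF n2] dih_2_comaximal
      set_mult_carrier_commute[OF subgroup_dih[OF n2] subgroup_dih[OF n2] dih_2_comaximal] n2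
    by (auto simp: X_def Y_def)
  have pair: "p = 2 \<and> (H \<in> {X, Y} \<or> K \<in> {X, Y})"
    if eHK: "e \<in> comaximal_hyperedges G" "H \<in> e" "K \<in> e" "H \<noteq> K" and ne: "H \<noteq> rots" "K \<noteq> rots" for e H K
  proof -
    have H: "H \<in> nontrivial_proper_subgroups G" and K: "K \<in> nontrivial_proper_subgroups G"
      and HK: "H <#> K = carrier G" and KH: "K <#> H = carrier G"
      using hyperedge_proper hyperedge_comaximal eHK by metis+
    obtain i where i: "el i True \<in> H"
      using comaximal_has_reflection[OF H ne(1) K ne(2) HK] .
    obtain j where j: "el j True \<in> K"
      using comaximal_has_reflection[OF K ne(2) H ne(1) KH] .
    have "p = 2"
      using comaximal_reflections[OF H ne(1) K ne(2) HK i j] by simp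
    then show ?thesis
      using comaximal_dih_2[OF H ne(1) K ne(2) HK] by (simp add: X_def Y_def)
  qed
  let ?E = "comaximal_hyperedges G"
  have "planar_hypergraph (comaximal_vertices G, ?E)"
  proof (rule star_like_hypergraph_planar[of ?E _ X Y rots])
    show "finite ?E"
      using finite_comaximal_vertices[OF finite_carrier]
      by (rule finite_subset[rotated, OF finite_Pow_iff[THEN iffD2]]) (auto simp: comaximal_hyperedges_def)
    show "\<Union>?E \<subseteq> comaximal_vertices G"
      by (auto simp: comaximal_hyperedges_def)
  next
    fix v
    assume "v \<in> comaximal_vertices G"
    then have "{v} \<subseteq> comaximal_vertices G"
      by simp
    then show "\<exists>e\<in>?E. v \<in> e"
      by (rule comaximal_hyperedge_extend[OF finite_carrier]) auto
  next
    fix v e f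
    assume v: "v \<notin> {rots, X, Y}" and e: "e \<in> ?E" "v \<in> e" and f: "f \<in> ?E" "v \<in> f"
    \<comment> \<open>Besides \<open>v\<close>, the hyperedges through \<open>v\<close> have members
      only among \<open>rots\<close>, \<open>X\<close>, \<open>Y\<close>. Two distinct such members
      occur only for \<open>p = 2\<close>, where \<open>special\<close> makes them comaximal, so the
      union of \<open>e\<close> and \<open>f\<close> is a clique.\<close>
    have neighbour: "K = rots \<or> p = 2 \<and> K \<in> {X, Y}" if "K \<in> e \<union> f - {v}" for K
      using pair[of e v K] pair[of f v K] v e f that by blast
    show "e = f"
    proof (rule comaximal_hyperedges_eqI[OF e(1) f(1), of "{v}"])
      fix K L
      assume "K \<in> e \<union> f - {v}" "L \<in> e \<union> f - {v}" "K \<noteq> L"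
      then show "K <#> L = carrier G"
        using neighbour[of K] neighbour[of L] special[of K L] by blast
    qed (use e f in blast)
  next
    fix e v w
    assume "e \<in> ?E" "v \<in> e - {rots, X, Y}" "w \<in> e - {rots, X, Y}"
    then show "v = w"
      using pair[of e v w] by blast
  next
    fix e f
    assume e: "e \<in> ?E" "{X, Y} \<subseteq> e" and f: "f \<in> ?E" "{X, Y} \<subseteq> f"
    have X: "X \<in> nontrivial_proper_subgroups G" and Y: "Y \<in> nontrivial_proper_subgroups G"
      using hyperedge_proper[OF e(1)] e(2) by auto
    have p2: "p = 2"
      using XY_vertex X by blast
    have refl: "el 0 True \<in> X" "el 1 True \<in> Y"
      using n2[OF p2] by (simp_all add: p2 X_def Y_def el_in_dih)
    \<comment> \<open>Another member would contain a reflection \<open>a^j b\<close> with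
      \<open>j\<close> differing by an odd number from both 0 and 1, the exponents in
      \<open>refl\<close>.\<close>
    have only_rots: "K = rots" if g: "g \<in> ?E" "{X, Y} \<subseteq> g" and K: "K \<in> g - {X, Y}" for K g
    proof (rule ccontr)
      assume ne: "K \<noteq> rots"
      have K': "K \<in> nontrivial_proper_subgroups G" and KX: "K <#> X = carrier G" and KY: "K <#> Y = carrier G"
        using hyperedge_proper[OF g(1), of K] hyperedge_comaximal[OF g(1), of K] g(2) K by auto
      obtain j where j: "el j True \<in> K"
        using comaximal_has_reflection[OF K' ne X XY(2) KX] .
      have "odd (j - 0)" "odd (j - 1)"
        using comaximal_reflections[OF K' ne X XY(2) KX j refl(1)]
          comaximal_reflections[OF K' ne Y XY(3) KY j refl(2)] by auto
      then show False
        by simp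
    qed
    show "e = f"
    proof (rule comaximal_hyperedges_eqI[OF e(1) f(1), of "{X, Y}"])
      fix K L
      assume "K \<in> e \<union> f - {X, Y}" "L \<in> e \<union> f - {X, Y}" "K \<noteq> L"
      then show "K <#> L = carrier G"
        using only_rots[OF e] only_rots[OF f] by blast
    qed (use e f in blast)
  qed (use XY in auto)
  then show ?thesis
    by (simp add: comaximal_hypergraph_def)
qed

end

end

theorem theorem3p3:
  fixes n :: nat and G :: "('a, 'b) monoid_scheme"
  assumes "n \<ge> 2" and "dihedral_group n G"
  shows "planar_hypergraph (comaximal_hypergraph G) \<longleftrightarrow>
         (\<exists>(p::nat) (\<alpha>::nat). prime p \<and> \<alpha> > 0 \<and> n = p ^ \<alpha>)"
proof -
  obtain el where "dihedral_coordinates G n el"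
    using dihedral_group_coordinates[OF assms] .
  then interpret dihedral_coordinates G n el .
  show ?thesis
    using not_planar_if_not_prime_power planar_if_prime_power by blast
qed

end
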